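(* Let $1\le q\le p<n$, let $w\in A_{q,\mathcal R}$ in $\mathbb{R}^{n}$, let $\delta>0$, and let $p_w^*$ be defined by $$\frac{1}{p} -\frac{1}{ p_w^* }=\frac{\delta}{n}\,\frac{1}{q+\log [w]_{A_{q,\mathcal R}}},$$ where it is understood that $\delta$ is such that $0<p_w^*<\infty$. For a locally integrable function $f$ and $R\in\mathcal R$ put $$A(R,x)= \int_R \frac{|f(x)-f(y)|^p}{|x-y|^{n+\delta p}} \,dy, \qquad x\in R.$$ Then, for a constant $C_{n,p,q}$ depending only on $n,p,q$, for every $R\in\mathcal R$, $$\left( \frac1{w(R)}\int_R|f-f_R|^{p_w^*}\,w\,dx\right)^{\frac1{p_w^*}}\leq C_{n,p,q}\,\frac{1}{\delta}\, [w]^{\frac{1}{p}}_{A_{p,\mathcal R}}\,\frac{d(R)^{\delta}}{e(R)^{\frac{n}{p}}}\left( \frac{1}{w(R)} \int_R A(R,x)\,w(x)\,dx\right)^{\frac{1}{p}}.$$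
   Context: $\mathcal R$ is the family of rectangles in $\mathbb{R}^n$, i.e. $n$-fold products of bounded intervals of $\mathbb R$; $d(R)$ is the diameter of $R$, $|R|$ its Lebesgue measure, and $f_R=\frac1{|R|}\int_R f\,dx$. The eccentricity of $R$ is $e(R):=|R|^{1/n}/d(R)$. A weight is a nonnegative locally integrable function $w$, and $w(E)=\int_E w\,dx$. For $1<r<\infty$, $[w]_{A_{r,\mathcal R}}:=\sup_{R\in\mathcal R}\big(\frac1{|R|}\int_R w\big)\big(\frac1{|R|}\int_R w^{-\frac1{r-1}}\big)^{r-1}$; $[w]_{A_{1,\mathcal R}}$ is the smallest $c$ with $\frac1{|R|}\int_R w\le c\,\operatorname{ess\,inf}_R w$ for all $R\in\mathcal R$. $A_{r,\mathcal R}$ is the class of weights for which $[w]_{A_{r,\mathcal R}}<\infty$. *)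

theory Defs
  imports "HOL-Analysis.Analysis"
begin

(* Real powers of extended nonnegative numbers, with top^a = top for a > 0, x^0 = 1,
   and x^a = 1 / x^(-a) for a < 0; in particular 0^a = top for a < 0. *)
definition epowr :: "ennreal \<Rightarrow> real \<Rightarrow> ennreal"  (infixr \<open>epowr\<close> 80)
  where "x epowr a =
    (if a = 0 then 1
     else if a > 0 then (if x = top then top else ennreal (enn2real x powr a))
     else inverse (if x = top then top else ennreal (enn2real x powr (- a))))"

(* The factors are arbitrary (open, closed, half-open) bounded intervals; nonempty interior
   excludes degenerate rectangles, for which averages make no sense. *)
definition rectangles :: "(real ^ 'n) set set"
  where "rectangles =
    {R. \<exists>I :: 'n \<Rightarrow> real set.
          (\<forall>i. is_interval (I i) \<and> bounded (I i) \<and> interior (I i) \<noteq> {}) \<and>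
          R = {x. \<forall>i. x $ i \<in> I i}}"

definition eccentricity :: "(real ^ 'n) set \<Rightarrow> real"
  where "eccentricity R = measure lebesgue R powr (1 / real CARD('n)) / diameter R"

definition locally_integrable :: "(real ^ 'n \<Rightarrow> real) \<Rightarrow> bool"
  where "locally_integrable f \<longleftrightarrow> (\<forall>K. compact K \<longrightarrow> f absolutely_integrable_on K)"

definition average :: "(real ^ 'n) set \<Rightarrow> (real ^ 'n \<Rightarrow> real) \<Rightarrow> real"
  where "average R f = set_lebesgue_integral lebesgue R f / measure lebesgue R"

(* Average of a [0, top]-valued function, possibly infinite. *)
definition eaverage :: "(real ^ 'n) set \<Rightarrow> (real ^ 'n \<Rightarrow> ennreal) \<Rightarrow> ennreal"
  where "eaverage R g = (\<integral>\<^sup>+x\<in>R. g x \<partial>lebesgue) / emeasure lebesgue R"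

definition weight :: "(real ^ 'n \<Rightarrow> real) \<Rightarrow> bool"
  where "weight w \<longleftrightarrow> (\<forall>x. 0 \<le> w x) \<and> locally_integrable w"

definition wmeasure :: "(real ^ 'n \<Rightarrow> real) \<Rightarrow> (real ^ 'n) set \<Rightarrow> ennreal"
  where "wmeasure w E = (\<integral>\<^sup>+x\<in>E. ennreal (w x) \<partial>lebesgue)"

definition ess_inf_on :: "(real ^ 'n) set \<Rightarrow> (real ^ 'n \<Rightarrow> real) \<Rightarrow> ennreal"
  where "ess_inf_on R w = Sup {c. AE x in lebesgue_on R. c \<le> ennreal (w x)}"

(* Meaningful for r >= 1.  The negative power of w takes the value top where w vanishes, so
   a weight vanishing on a set of positive measure has constant top, unless it vanishes
   almost everywhere; in that case the convention 0 * top = 0 gives constant 0. *)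
definition Ar_const :: "real \<Rightarrow> (real ^ 'n \<Rightarrow> real) \<Rightarrow> ennreal"
  where "Ar_const r w =
    (if r = 1 then
       Inf {c. \<forall>R\<in>rectangles. eaverage R (\<lambda>x. ennreal (w x)) \<le> c * ess_inf_on R w}
     else
       (SUP R\<in>rectangles. eaverage R (\<lambda>x. ennreal (w x)) *
          eaverage R (\<lambda>x. ennreal (w x) epowr (- 1 / (r - 1))) epowr (r - 1)))"

definition Ar_class :: "real \<Rightarrow> (real ^ 'n \<Rightarrow> real) set"
  where "Ar_class r = {w. weight w \<and> Ar_const r w < top}"

(* The single point y = x, where the quotient is 0 / 0 = 0, does not affect the integral. *)
definition A_functional ::
    "real \<Rightarrow> real \<Rightarrow> (real ^ 'n \<Rightarrow> real) \<Rightarrow> (real ^ 'n) set \<Rightarrow> real ^ 'n \<Rightarrow> ennreal"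
  where "A_functional p \<delta> f R x =
    (\<integral>\<^sup>+y\<in>R. ennreal (\<bar>f x - f y\<bar> powr p / norm (x - y) powr (real CARD('n) + \<delta> * p))
       \<partial>lebesgue)"

end

theory Submission
  imports Defs
begin

text \<open>For \<open>\<delta> \<le> 1\<close> the proof is pointwise.  Shrink \<open>R\<close> towards a point \<open>x\<close> by the homotheties of ratio
  \<open>2 ^ -k\<close>; all the cells \<open>P\<^sub>k\<close> have the eccentricity of \<open>R\<close>.  Hoelder's inequality gives
  \<open>|f x - f\<^bsub>P\<^sub>k\<^esub>| \<lesssim> 2 ^ (-k\<delta>) A(R,x) ^ (1/p)\<close>, and the \<open>A\<^sub>p\<close> and \<open>A\<^sub>q\<close> conditions bound the differences of
  consecutive averages by a growing geometric sequence in \<open>k\<close> times the global right-hand side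
  (here \<open>p < n\<close> is used).  Stopping at the best \<open>k\<close> yields
  \<open>|f x - f\<^sub>R| ^ pstar \<lesssim> A(R,x)\<close> up to the correct constants, which is integrated against \<open>w\<close>.
  For \<open>\<delta> > 1\<close> a finite right-hand side forces \<open>f\<close> to be constant almost everywhere on \<open>R\<close>.\<close>

text \<open>Write K and L for the A_q and A_p constants. Comparing f x with its average over P_k
  involves no weight, so the weight enters only through the differences of averages. A_p on P_k
  turns the weighted integral of A(R,.) into a bound for the unweighted mean of its power 1/p, at
  the price of (L w(R) / w(P_k)) powr (1/p); A_q on R bounds w(R) / w(P_k) by K * 2 powr (k * n *
  q). Optimising k turns this growth into a loss K powr \<sigma>, where \<sigma> = 1/p - 1/pstar:
  the summand log [w] in the definition of pstar keeps the loss below exp 1, and the summand q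
  matches the growth in k. The chain of averages is finite, so neither Lebesgue differentiation nor
  a sum of 2 powr (-j * \<delta>) over all j occurs; such a sum would cost a factor of order
  1/\<delta>. The factor 1/\<delta> of the claim is simply at least 1 when \<delta> \<le> 1. For
  \<delta> > 1 the ratio 2 powr (n * q / p - \<delta>) of consecutive bounds need not exceed 1,
  hence the separate argument.\<close>

section \<open>Hoelder's inequality and extended powers\<close>

lemma nn_integral_Holder:
  fixes u v :: "'a \<Rightarrow> real"
  assumes [measurable]: "u \<in> borel_measurable M" "v \<in> borel_measurable M"
    and s: "0 \<le> s" "s \<le> 1" and u0: "\<And>x. 0 \<le> u x" and v0: "\<And>x. 0 \<le> v x"
    and U: "(\<integral>\<^sup>+x. ennreal (u x) \<partial>M) \<le> ennreal U" "0 \<le> U"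
    and V: "(\<integral>\<^sup>+x. ennreal (v x) \<partial>M) \<le> ennreal V" "0 \<le> V"
  shows "(\<integral>\<^sup>+x. ennreal (u x powr s * v x powr (1 - s)) \<partial>M) \<le> ennreal (U powr s * V powr (1 - s))"
proof (cases "U = 0 \<or> V = 0")
  \<comment> \<open>The exponents s and 1 - s include the endpoint s = 1, needed for p = 1. Since
    \<open>0 powr 0 = 0\<close>, the bound is 0 here even at an endpoint, and the integrand vanishes
    almost everywhere for the same reason.\<close>
  case True
  have "AE x in M. u x powr s * v x powr (1 - s) = 0"
  proof (cases "U = 0")
    case True
    then have "AE x in M. ennreal (u x) = 0"
      using U by (subst nn_integral_0_iff_AE[symmetric]) auto
    then show ?thesis by eventually_elim (use u0 in \<open>simp add: ennreal_eq_0_iff order_antisym\<close>)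
  next
    case False
    with True have "AE x in M. ennreal (v x) = 0"
      using V by (subst nn_integral_0_iff_AE[symmetric]) auto
    then show ?thesis by eventually_elim (use v0 in \<open>simp add: ennreal_eq_0_iff order_antisym\<close>)
  qed
  then have "AE x in M. ennreal (u x powr s * v x powr (1 - s)) = 0"
    by eventually_elim simp
  then have "(\<integral>\<^sup>+x. ennreal (u x powr s * v x powr (1 - s)) \<partial>M) = (\<integral>\<^sup>+x. 0 \<partial>M)"
    by (rule nn_integral_cong_AE)
  then show ?thesis by simp
next
  case False
  then have pos: "U > 0" "V > 0" using U V by auto
  let ?c = "U powr s * V powr (1 - s)"
  have young: "a powr s * b powr (1 - s) \<le> s * a + (1 - s) * b" if "a \<ge> 0" "b \<ge> 0" for a b :: real
    using Youngs_inequality_0[of s "1 - s" a b] s that by (cases "a = 0 \<or> b = 0") auto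
  have pt: "u x powr s * v x powr (1 - s) \<le> ?c * s / U * u x + ?c * (1 - s) / V * v x" for x
  proof -
    have "u x powr s * v x powr (1 - s) = ?c * ((u x / U) powr s * (v x / V) powr (1 - s))"
      using pos u0[of x] v0[of x] by (simp add: powr_divide)
    also have "\<dots> \<le> ?c * (s * (u x / U) + (1 - s) * (v x / V))"
      using pos u0[of x] v0[of x] by (intro mult_left_mono young) auto
    finally show ?thesis by (simp add: algebra_simps)
  qed
  have "(\<integral>\<^sup>+x. ennreal (u x powr s * v x powr (1 - s)) \<partial>M)
      \<le> (\<integral>\<^sup>+x. ennreal (?c * s / U) * ennreal (u x) + ennreal (?c * (1 - s) / V) * ennreal (v x) \<partial>M)"
  proof (rule nn_integral_mono)
    fix x
    have "ennreal (u x powr s * v x powr (1 - s)) \<le> ennreal (?c * s / U * u x + ?c * (1 - s) / V * v x)"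
      by (rule ennreal_leI[OF pt])
    also have "\<dots> = ennreal (?c * s / U) * ennreal (u x) + ennreal (?c * (1 - s) / V) * ennreal (v x)"
      using s pos u0[of x] v0[of x] by (subst ennreal_plus) (simp_all add: ennreal_mult[symmetric])
    finally show "ennreal (u x powr s * v x powr (1 - s)) \<le> \<dots>" .
  qed
  also have "\<dots> = ennreal (?c * s / U) * (\<integral>\<^sup>+x. ennreal (u x) \<partial>M) + ennreal (?c * (1 - s) / V) * (\<integral>\<^sup>+x. ennreal (v x) \<partial>M)"
    by (simp add: nn_integral_add nn_integral_cmult)
  also have "\<dots> \<le> ennreal (?c * s / U) * ennreal U + ennreal (?c * (1 - s) / V) * ennreal V"
    by (intro add_mono mult_left_mono U V) auto
  also have "\<dots> = ennreal (?c * s / U * U + ?c * (1 - s) / V * V)"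
    using s pos by (subst ennreal_plus) (simp_all add: ennreal_mult[symmetric] del: times_divide_eq_left)
  also have "?c * s / U * U + ?c * (1 - s) / V * V = ?c"
    using pos by (simp add: distrib_left[symmetric])
  finally show ?thesis .
qed

lemma ennreal_epowr: "0 \<le> x \<Longrightarrow> 0 < a \<Longrightarrow> ennreal x epowr a = ennreal (x powr a)"
  by (simp add: epowr_def)

lemma top_epowr: "0 < a \<Longrightarrow> top epowr a = top"
  by (simp add: epowr_def)

lemma epowr_mono: "x \<le> y \<Longrightarrow> 0 < a \<Longrightarrow> x epowr a \<le> y epowr a"
  by (cases x; cases y) (auto simp: epowr_def top_unique intro!: ennreal_leI powr_mono2)

lemma ennreal_epowr_neg:
  assumes "0 < a"
  shows "ennreal x epowr (- a) = (if x > 0 then ennreal (x powr (- a)) else top)"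
proof (cases "x > 0")
  case True
  then show ?thesis
    using assms by (simp add: epowr_def powr_minus inverse_ennreal)
next
  case False
  then show ?thesis using assms by (simp add: epowr_def ennreal_neg)
qed

section \<open>Rectangles and locally integrable functions\<close>

lemma rectangles_properties:
  fixes R :: "(real ^ 'n) set"
  assumes "R \<in> rectangles"
  shows "convex R" "bounded R" "R \<in> lmeasurable" "0 < measure lebesgue R" "interior R \<noteq> {}"
proof -
  from assms obtain I :: "'n \<Rightarrow> real set" where
    I': "\<forall>i. is_interval (I i) \<and> bounded (I i) \<and> interior (I i) \<noteq> {}"
    and R: "R = {x. \<forall>i. x $ i \<in> I i}"
    unfolding rectangles_def mem_Collect_eq by (elim exE conjE)
  have I: "is_interval (I i)" "bounded (I i)" "interior (I i) \<noteq> {}" for i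
    using I' by simp_all
  show c: "convex R"
  proof (rule convexI)
    fix x y :: "real ^ 'n" and a b :: real assume xy: "x \<in> R" "y \<in> R" and ab: "0 \<le> a" "0 \<le> b" "a + b = 1"
    have "a * x $ i + b * y $ i \<in> I i" for i
      using convexD[of "I i" "x $ i" "y $ i" a b] xy ab I(1)[of i] by (simp add: R is_interval_convex_1)
    then show "a *\<^sub>R x + b *\<^sub>R y \<in> R" by (simp add: R)
  qed
  have "\<forall>i. \<exists>B. \<forall>t\<in>I i. \<bar>t\<bar> \<le> B"
    using I(2) by (simp add: bounded_iff)
  then obtain B where "\<forall>i. \<forall>t\<in>I i. \<bar>t\<bar> \<le> B i"
    by (rule choice[THEN exE]) blast
  then have B: "\<bar>t\<bar> \<le> B i" if "t \<in> I i" for i t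
    using that by blast
  show b: "bounded R"
    unfolding bounded_iff
  proof (intro exI ballI)
    fix x assume "x \<in> R"
    then have "\<And>i. \<bar>x $ i\<bar> \<le> B i" using B R by auto
    then show "norm x \<le> (\<Sum>i\<in>UNIV. B i)"
      using norm_le_l1_cart[of x] sum_mono[of UNIV "\<lambda>i. \<bar>x $ i\<bar>" B] by force
  qed
  show m: "R \<in> lmeasurable" using c b by (rule measurable_convex)
  define z where "z i = (SOME t. t \<in> interior (I i))" for i
  have z: "z i \<in> interior (I i)" for i
    using I(3)[of i] unfolding z_def by (simp add: some_in_eq)
  have op: "open {x :: real ^ 'n. \<forall>i. x $ i \<in> interior (I i)}"
  proof -
    have "{x :: real ^ 'n. \<forall>i. x $ i \<in> interior (I i)} = (\<Inter>i. (\<lambda>x. x $ i) -` interior (I i))" by auto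
    moreover have "open \<dots>"
      by (intro open_INT) (auto intro!: open_vimage_vec_nth)
    ultimately show ?thesis by simp
  qed
  have "{x :: real ^ 'n. \<forall>i. x $ i \<in> interior (I i)} \<subseteq> R"
    unfolding R using interior_subset[of "I _"] by (auto simp: subset_iff)
  then have "(\<chi> i. z i) \<in> interior R"
    using op z by (intro interiorI) auto
  then show ne: "interior R \<noteq> {}" by auto
  have "\<not> negligible R"
    using open_not_negligible[OF open_interior ne] negligible_subset[of R "interior R"] interior_subset[of R] by metis
  then have "measure lebesgue R \<noteq> 0"
    using m by (simp add: negligible_iff_measure)
  then show "0 < measure lebesgue R"
    using measure_nonneg[of lebesgue R] by linarith
qed

lemma locally_integrable_measurable:
  assumes "locally_integrable f"
  shows "f \<in> borel_measurable lebesgue"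
proof (rule borel_measurable_LIMSEQ_real)
  fix k :: nat
  have "f absolutely_integrable_on cball 0 (real k)"
    using assms by (auto simp: locally_integrable_def)
  then show "(\<lambda>x. indicator (cball 0 (real k)) x * f x) \<in> borel_measurable lebesgue"
    unfolding set_integrable_def by (auto dest: borel_measurable_integrable)
next
  fix x
  have "\<forall>\<^sub>F k in sequentially. indicator (cball 0 (real k)) x * f x = f x"
    unfolding eventually_sequentially
    by (metis indicator_simps(1) mem_cball_0 mult_1 of_nat_le_iff order_trans real_nat_ceiling_ge)
  then show "(\<lambda>k. indicator (cball 0 (real k)) x * f x) \<longlonglongrightarrow> f x"
    by (rule tendsto_eventually)
qed

lemma locally_integrable_integrable_on:
  assumes "locally_integrable f" "bounded R" "R \<in> sets lebesgue"
  shows "set_integrable lebesgue R f"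
proof (rule set_integrable_subset)
  show "set_integrable lebesgue (closure R) f"
    using assms by (auto simp: locally_integrable_def compact_closure)
qed (use assms closure_subset in auto)

section \<open>Consequences of the A_r condition\<close>

text \<open>For r > 1, write g powr (1/r) as (g * w) powr (1/r) times the power 1 - 1/r of the dual
  weight w powr (-1/(r-1)) and apply Hoelder's inequality; the A_r condition bounds the integral of
  the dual weight. For r = 1, w is bounded below by its average divided by K. All later uses of the
  A_r condition go through this test.\<close>

lemma Ar_test:
  fixes w g :: "real ^ 'n \<Rightarrow> real"
  assumes r: "1 \<le> r" and w: "weight w" and K: "Ar_const r w = ennreal K" "0 \<le> K"
    and P: "P \<in> rectangles" and W: "wmeasure w P = ennreal W" "0 < W"
    and [measurable]: "g \<in> borel_measurable lebesgue" and g0: "\<And>x. 0 \<le> g x"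
    and U: "(\<integral>\<^sup>+x\<in>P. ennreal (g x * w x) \<partial>lebesgue) \<le> ennreal U" "0 \<le> U"
  shows "(\<integral>\<^sup>+x\<in>P. ennreal (g x powr (1 / r)) \<partial>lebesgue)
    \<le> ennreal (measure lebesgue P * (K * U / W) powr (1 / r))"
proof -
  note Rp = rectangles_properties[OF P]
  define v where "v = measure lebesgue P"
  have v: "v > 0" "emeasure lebesgue P = ennreal v"
    using Rp by (auto simp: v_def emeasure_eq_measure2)
  have [measurable]: "w \<in> borel_measurable lebesgue"
    using w by (auto simp: weight_def intro: locally_integrable_measurable)
  have [measurable]: "P \<in> sets lebesgue" using Rp by auto
  have w0: "0 \<le> w x" for x using w by (auto simp: weight_def)
  have avg: "eaverage P (\<lambda>x. ennreal (w x)) = ennreal (W / v)"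
    using W v by (simp add: eaverage_def wmeasure_def divide_ennreal)
  show ?thesis
  proof (cases "r = 1")
    case True
    define I where "I = (\<integral>\<^sup>+x\<in>P. ennreal (g x) \<partial>lebesgue)"
    \<comment> \<open>Neither the infimum defining the A_1 constant nor the supremum defining the
      essential infimum is assumed attained, so w is bounded below only by c strictly under W / (v *
      K). The form c * K < W / v also covers K = 0; the limit in c is taken below.\<close>
    have cI: "ennreal c * I \<le> ennreal U" if c: "0 < c" "c * K < W / v" for c
    proof -
      obtain k where k: "K < k" "c * k < W / v"
        using c dense[of K "W / v / c"] by (metis mult.commute pos_less_divide_eq)
      have "Ar_const r w < ennreal k"
        using K k by (simp add: ennreal_lessI)
      then obtain k' where k': "k' < ennreal k"
        "\<forall>R\<in>rectangles. eaverage R (\<lambda>x. ennreal (w x)) \<le> k' * ess_inf_on R w"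
        using True by (auto simp: Ar_const_def Inf_less_iff)
      then have "ennreal (W / v) \<le> ennreal k * ess_inf_on P w"
        using P avg by (metis less_imp_le mult_right_mono order_trans zero_le)
      moreover have "ennreal k * ennreal c < ennreal (W / v)"
        using k K c W v by (simp add: ennreal_mult[symmetric] ennreal_lessI mult.commute del: ennreal_less_iff)
      ultimately have "ennreal k * ennreal c < ennreal k * ess_inf_on P w"
        by (rule less_le_trans[rotated])
      then have "ennreal c < ess_inf_on P w"
        by (meson leD leI mult_left_mono zero_le)
      then obtain c' where "ennreal c < c'" and c': "AE x in lebesgue_on P. c' \<le> ennreal (w x)"
        by (auto simp: ess_inf_on_def less_Sup_iff)
      then have ae: "AE x in lebesgue. x \<in> P \<longrightarrow> ennreal c \<le> ennreal (w x)"
        by (subst (asm) AE_restrict_space_iff) (auto elim!: eventually_mono)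
      have "ennreal c * I = (\<integral>\<^sup>+x\<in>P. ennreal c * ennreal (g x) \<partial>lebesgue)"
        by (simp add: I_def nn_integral_cmult mult.assoc)
      also have "\<dots> \<le> (\<integral>\<^sup>+x\<in>P. ennreal (g x * w x) \<partial>lebesgue)"
      proof (intro nn_integral_mono_AE, use ae in eventually_elim)
        fix x assume x: "x \<in> P \<longrightarrow> ennreal c \<le> ennreal (w x)"
        show "ennreal c * ennreal (g x) * indicator P x \<le> ennreal (g x * w x) * indicator P x"
        proof (cases "x \<in> P")
          case True
          then have "c \<le> w x" using x c w0[of x] by (simp add: ennreal_le_iff)
          then have "c * g x \<le> g x * w x" using g0[of x] by (metis mult.commute mult_left_mono)
          then show ?thesis using c g0[of x] True by (simp add: ennreal_mult[symmetric] ennreal_leI)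
        qed simp
      qed
      finally show ?thesis using U by simp
    qed
    obtain c0 where c0: "0 < c0" "c0 * K < W / v"
    proof (cases "K = 0")
      case True then show ?thesis using that[of 1] W v by simp
    next
      case False then show ?thesis using that[of "W / v / K / 2"] W v K by (simp add: field_simps)
    qed
    have "I < top"
      using cI[OF c0] c0 by (metis ennreal_less_top ennreal_mult_eq_top_iff ennreal_eq_0_iff infinity_ennreal_def leD less_top linorder_not_le)
    then obtain i where i: "I = ennreal i" "i \<ge> 0" by (cases I) auto
    have ci: "c * i \<le> U" if "0 < c" "c * K < W / v" for c
      using cI[OF that] i U that by (simp add: ennreal_mult[symmetric])
    have "i \<le> v * (K * U / W)"
    proof (cases "K = 0")
      case True
      \<comment> \<open>With K = 0 every positive c is admissible, and c * i \<le> U for all of them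
        forces i = 0.\<close>
      have "i \<le> 0"
      proof (rule ccontr)
        assume "\<not> i \<le> 0"
        then show False using ci[of "(U + 1) / i"] True W v U by simp
      qed
      then show ?thesis using True by simp
    next
      case False
      have "W / v / K * i \<le> U"
      proof (cases "i = 0")
        case False
        have "W / v / K \<le> U / i"
        proof (rule dense_le_bounded[of 0])
          show "0 < W / v / K" using W v K \<open>K \<noteq> 0\<close> by simp
          fix c assume "0 < c" "c < W / v / K"
          then show "c \<le> U / i"
            using ci[of c] False i K v \<open>K \<noteq> 0\<close> by (simp add: field_simps)
        qed
        then show ?thesis using False i by (simp add: field_simps)
      qed (use U in simp)
      then show ?thesis using False K W v by (simp add: field_simps)
    qed
    then show ?thesis
      using i True g0 K U W by (simp add: I_def v_def ennreal_leI)
  next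
    case False
    define s where "s = 1 / r"
    have r1: "r > 1" using False r by simp
    have s: "0 \<le> s" "s \<le> 1" "s > 0" using r by (auto simp: s_def)
    have conj: "1 / (r - 1) * (1 - s) = s" using r1 by (simp add: s_def field_simps)
    define \<sigma> where "\<sigma> x = w x powr (- (1 / (r - 1)))" for x
    have eps: "ennreal (w x) epowr (- 1 / (r - 1)) = (if w x > 0 then ennreal (\<sigma> x) else top)" for x
      using ennreal_epowr_neg[of "1 / (r - 1)" "w x"] r1 by (simp add: \<sigma>_def)
    define J where "J = (\<integral>\<^sup>+x\<in>P. (if w x > 0 then ennreal (\<sigma> x) else top) \<partial>lebesgue)"
    have meas: "(\<lambda>x. if w x > 0 then ennreal (\<sigma> x) else top) \<in> borel_measurable lebesgue"
      unfolding \<sigma>_def by measurable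
    have "eaverage P (\<lambda>x. ennreal (w x)) * eaverage P (\<lambda>x. ennreal (w x) epowr (- 1 / (r - 1))) epowr (r - 1)
        \<le> Ar_const r w"
      using P False by (auto simp: Ar_const_def intro!: SUP_upper)
    then have bd: "ennreal (W / v) * (J / ennreal v) epowr (r - 1) \<le> ennreal K"
      unfolding avg K eps by (simp add: eaverage_def J_def v)
    have "J < top"
    proof (rule ccontr)
      assume "\<not> J < top"
      then have "J / ennreal v = top" using v by (simp add: less_top[symmetric] ennreal_top_divide)
      then show False using bd r1 W v by (simp add: top_epowr ennreal_mult_top top_unique)
    qed
    then obtain V where V: "J = ennreal V" "V \<ge> 0" by (cases J) auto
    have "W / v * (V / v) powr (r - 1) \<le> K"
      using bd V W v r1 K by (simp add: divide_ennreal ennreal_epowr ennreal_mult[symmetric])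
    then have "(V / v) powr (r - 1) \<le> K * v / W" using W v by (simp add: field_simps)
    then have "((V / v) powr (r - 1)) powr (1 / (r - 1)) \<le> (K * v / W) powr (1 / (r - 1))"
      using r1 by (intro powr_mono2) auto
    then have Vb: "V / v \<le> (K * v / W) powr (1 / (r - 1))"
      using V v r1 by (simp add: powr_powr)
    \<comment> \<open>At zeros of w the real power \<open>\<sigma>\<close> is 0 whereas the extended
      power is \<open>top\<close>; finiteness of \<open>J\<close> confines this discrepancy to a
      null set.\<close>
    have wpos: "AE x in lebesgue. x \<in> P \<longrightarrow> w x > 0"
    proof -
      have "AE x in lebesgue. (if w x > 0 then ennreal (\<sigma> x) else top) * indicator P x \<noteq> top"
        using nn_integral_PInf_AE[of "\<lambda>x. (if w x > 0 then ennreal (\<sigma> x) else top) * indicator P x" lebesgue]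
          \<open>J < top\<close> meas by (simp add: J_def less_top)
      then show ?thesis by eventually_elim (auto split: if_splits)
    qed
    have "(\<integral>\<^sup>+x\<in>P. ennreal (g x powr s) \<partial>lebesgue)
        \<le> (\<integral>\<^sup>+x. ennreal ((g x * w x * indicator P x) powr s * (\<sigma> x * indicator P x) powr (1 - s)) \<partial>lebesgue)"
    proof (intro nn_integral_mono_AE, use wpos in eventually_elim)
      fix x assume x: "x \<in> P \<longrightarrow> w x > 0"
      show "ennreal (g x powr s) * indicator P x
        \<le> ennreal ((g x * w x * indicator P x) powr s * (\<sigma> x * indicator P x) powr (1 - s))"
      proof (cases "x \<in> P")
        case True
        with x have "w x > 0" by simp
        moreover have "\<sigma> x powr (1 - s) = w x powr (- s)"
          using conj by (simp add: \<sigma>_def powr_powr)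
        ultimately show ?thesis
          using True g0[of x] by (simp add: powr_mult powr_minus field_simps)
      qed simp
    qed
    also have "\<dots> \<le> ennreal (U powr s * V powr (1 - s))"
    proof (rule nn_integral_Holder)
      show "(\<lambda>x. \<sigma> x * indicator P x) \<in> borel_measurable lebesgue" unfolding \<sigma>_def by measurable
      show "(\<integral>\<^sup>+x. ennreal (g x * w x * indicator P x) \<partial>lebesgue) \<le> ennreal U"
        using U by (simp add: indicator_mult_ennreal mult.commute)
      have "(\<integral>\<^sup>+x. ennreal (\<sigma> x * indicator P x) \<partial>lebesgue) \<le> J"
        unfolding J_def by (intro nn_integral_mono) (auto split: split_indicator)
      then show "(\<integral>\<^sup>+x. ennreal (\<sigma> x * indicator P x) \<partial>lebesgue) \<le> ennreal V" using V by simp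
    qed (use s U V g0 w0 in \<open>auto simp: \<sigma>_def\<close>)
    also have "U powr s * V powr (1 - s) \<le> v * (K * U / W) powr s"
    proof -
      have "V powr (1 - s) = v powr (1 - s) * (V / v) powr (1 - s)"
        using V v by (simp add: powr_mult[symmetric])
      also have "(V / v) powr (1 - s) \<le> ((K * v / W) powr (1 / (r - 1))) powr (1 - s)"
        using V v Vb s by (intro powr_mono2) auto
      also have "\<dots> = (K * v / W) powr s" using conj by (simp add: powr_powr)
      finally have "U powr s * V powr (1 - s) \<le> U powr s * (v powr (1 - s) * (K * v / W) powr s)"
        using v by (simp add: mult_left_mono)
      also have "\<dots> = v powr (1 - s) * v powr s * (K * U / W) powr s"
        using K U W v by (simp add: powr_mult powr_divide)
      also have "v powr (1 - s) * v powr s = v" using v by (simp add: powr_add[symmetric])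
      finally show ?thesis .
    qed
    finally show ?thesis by (simp add: s_def v_def ennreal_leI)
  qed
qed

text \<open>\<open>Ar_test\<close> for an indicator. Solved for the weight, it bounds w(E) from
  below by (|E| / |P|) powr r * w(P) / K, which compares a rectangle with its shrunken copies and
  excludes zeros of w.\<close>

lemma measure_le_Ar_const:
  fixes w :: "real ^ 'n \<Rightarrow> real"
  assumes r: "1 \<le> r" and w: "weight w" and K: "Ar_const r w = ennreal K" "0 \<le> K"
    and P: "P \<in> rectangles" and W: "wmeasure w P = ennreal W" "0 < W"
    and E: "E \<in> sets lebesgue" "E \<subseteq> P" and U: "wmeasure w E \<le> ennreal U" "0 \<le> U"
  shows "measure lebesgue E \<le> measure lebesgue P * (K * U / W) powr (1 / r)"
proof -
  note Rp = rectangles_properties[OF P]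
  have "E \<in> lmeasurable"
    using Rp E by (blast intro: fmeasurableI2)
  have "(\<integral>\<^sup>+x\<in>P. ennreal (indicator E x powr (1 / r)) \<partial>lebesgue)
    \<le> ennreal (measure lebesgue P * (K * U / W) powr (1 / r))"
  proof (rule Ar_test[OF r w K P W])
    have "(\<integral>\<^sup>+x\<in>P. ennreal (indicator E x * w x) \<partial>lebesgue) = wmeasure w E"
      unfolding wmeasure_def using E by (intro nn_integral_cong) (auto split: split_indicator)
    then show "(\<integral>\<^sup>+x\<in>P. ennreal (indicator E x * w x) \<partial>lebesgue) \<le> ennreal U" using U by simp
  qed (use E U in auto)
  moreover have "(\<integral>\<^sup>+x\<in>P. ennreal (indicator E x powr (1 / r)) \<partial>lebesgue) = (\<integral>\<^sup>+x. indicator E x \<partial>lebesgue)"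
    using E by (intro nn_integral_cong) (auto split: split_indicator)
  ultimately show ?thesis
    using \<open>E \<in> lmeasurable\<close> E K U W
    by (simp add: emeasure_eq_measure2)
qed

text \<open>The case E = P. Positivity of \<open>W\<close> matters: the zero weight has constant
  0.\<close>

lemma Ar_const_ge_1:
  fixes w :: "real ^ 'n \<Rightarrow> real"
  assumes r: "1 \<le> r" and w: "weight w" and K: "Ar_const r w = ennreal K" "0 \<le> K"
    and P: "P \<in> rectangles" and W: "wmeasure w P = ennreal W" "0 < W"
  shows "1 \<le> K"
proof (rule ccontr)
  assume "\<not> 1 \<le> K"
  then have "K powr (1 / r) < 1"
    using K r powr_less_mono2[of "1 / r" K 1] by simp
  moreover have "measure lebesgue P \<le> measure lebesgue P * K powr (1 / r)"
    using measure_le_Ar_const[OF assms _ order_refl, of W] W rectangles_properties[OF P] by auto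
  ultimately show False using rectangles_properties(4)[OF P] by (simp add: mult_le_cancel_left1)
qed

text \<open>The zero set of w in P has weight 0, so \<open>measure_le_Ar_const\<close> with U = 0
  gives it measure 0.\<close>

lemma weight_AE_pos:
  fixes w :: "real ^ 'n \<Rightarrow> real"
  assumes r: "1 \<le> r" and w: "weight w" and K: "Ar_const r w = ennreal K" "0 \<le> K"
    and P: "P \<in> rectangles" and W: "wmeasure w P = ennreal W" "0 < W"
  shows "AE x in lebesgue. x \<in> P \<longrightarrow> 0 < w x"
proof -
  note Rp = rectangles_properties[OF P]
  have [measurable]: "w \<in> borel_measurable lebesgue" "P \<in> sets lebesgue"
    using w Rp by (auto simp: weight_def intro: locally_integrable_measurable)
  define E where "E = {x \<in> space lebesgue. x \<in> P \<and> w x = 0}"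
  have "E = P \<inter> (w -` {0} \<inter> space lebesgue)" by (auto simp: E_def)
  moreover have "w -` {0} \<inter> space lebesgue \<in> sets lebesgue"
    by (rule measurable_sets[OF \<open>w \<in> borel_measurable lebesgue\<close>]) simp
  ultimately have E: "E \<in> sets lebesgue" "E \<subseteq> P"
    using \<open>P \<in> sets lebesgue\<close> by (simp_all add: sets.Int)
  have "wmeasure w E = (\<integral>\<^sup>+x. 0 \<partial>(lebesgue :: (real ^ 'n) measure))"
    unfolding wmeasure_def by (intro nn_integral_cong) (auto simp: E_def split: split_indicator)
  then have "measure lebesgue E = 0"
    using measure_le_Ar_const[OF assms E, of 0] by (simp add: measure_le_0_iff)
  moreover have "E \<in> lmeasurable" using Rp E by (blast intro: fmeasurableI2)
  ultimately have "E \<in> null_sets lebesgue"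
    using E by (simp add: null_sets_def emeasure_eq_measure2)
  then have "AE x in lebesgue. x \<notin> E" by (rule AE_not_in)
  then show ?thesis
  proof eventually_elim
    case (elim x)
    then show ?case using w by (auto simp: E_def weight_def order_less_le)
  qed
qed

section \<open>Measurability of the functional A(R,.)\<close>

lemma (in complete_measure) measurable_cong_AE:
  assumes f: "f \<in> M \<rightarrow>\<^sub>M N" and g: "\<And>x. x \<in> space M \<Longrightarrow> g x \<in> space N" and ae: "AE x in M. f x = g x"
  shows "g \<in> M \<rightarrow>\<^sub>M N"
proof (rule measurableI)
  fix A assume "A \<in> sets N"
  then have m: "f -` A \<inter> space M \<in> sets M" using f by measurable
  have ae': "AE x in M. x \<in> f -` A \<inter> space M \<longleftrightarrow> x \<in> g -` A \<inter> space M"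
    using ae by eventually_elim auto
  show "g -` A \<inter> space M \<in> sets M"
    by (rule in_sets_AE[OF ae' m]) simp
qed (use g in auto)

lemma A_functional_cong_AE:
  fixes f g :: "real ^ 'n \<Rightarrow> real"
  assumes "AE y in lebesgue. f y = g y" and "f x = g x"
    and "AE y in lebesgue. y \<in> R \<longleftrightarrow> y \<in> S"
  shows "A_functional p \<delta> f R x = A_functional p \<delta> g S x"
  unfolding A_functional_def
proof (intro nn_integral_cong_AE, use assms(1,3) in eventually_elim)
  case (elim y)
  then show ?case using assms(2) by (auto split: split_indicator)
qed

lemma A_functional_measurable_borel:
  fixes f :: "real ^ 'n \<Rightarrow> real"
  assumes [measurable]: "f \<in> borel_measurable borel" "R \<in> sets borel"
  shows "A_functional p \<delta> f R \<in> borel_measurable borel"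
proof -
  have "(\<lambda>x. \<integral>\<^sup>+y\<in>R. ennreal (\<bar>f x - f y\<bar> powr p / norm (x - y) powr (real CARD('n) + \<delta> * p)) \<partial>lborel)
      \<in> borel_measurable borel"
    by measurable
  then show ?thesis
    unfolding A_functional_def nn_integral_completion .
qed

lemma borel_version:
  fixes f :: "'a::euclidean_space \<Rightarrow> real"
  assumes "f \<in> borel_measurable lebesgue"
  obtains g where "g \<in> borel_measurable borel" "AE x in lebesgue. f x = g x"
proof -
  obtain g where "g \<in> borel_measurable lborel" "AE x in lborel. f x = g x"
    using completion_ex_borel_measurable_real[OF assms] by auto
  then show ?thesis using that[of g] by (simp add: AE_completion)
qed

lemma AE_mem_interior:
  fixes R :: "'a::euclidean_space set"
  assumes "convex R"
  shows "AE x in lebesgue. x \<in> R \<longleftrightarrow> x \<in> interior R"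
proof -
  have "frontier R \<in> null_sets lebesgue"
    using negligible_convex_frontier[OF assms] by (simp add: negligible_iff_null_sets)
  then have "AE x in lebesgue. x \<notin> frontier R" by (rule AE_not_in)
  then show ?thesis
  proof eventually_elim
    case (elim x)
    then show ?case using closure_subset[of R] interior_subset[of R] by (auto simp: frontier_def)
  qed
qed

text \<open>Parameter integrals of Borel functions are measurable. Passing to a Borel version of f
  and to the open set \<open>interior R\<close> changes the functional only at points x where the
  two versions of f differ; completeness of Lebesgue measure transfers measurability back.\<close>

lemma A_functional_measurable:
  fixes f :: "real ^ 'n \<Rightarrow> real"
  assumes f: "f \<in> borel_measurable lebesgue" and R: "convex R"
  shows "A_functional p \<delta> f R \<in> borel_measurable lebesgue"
proof -
  obtain g where g: "g \<in> borel_measurable borel" "AE x in lebesgue. f x = g x"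
    using borel_version[OF f] .
  have m: "A_functional p \<delta> g (interior R) \<in> borel_measurable lebesgue"
    using A_functional_measurable_borel[OF g(1), of "interior R"] by (simp add: measurable_completion)
  have ae: "AE x in lebesgue. A_functional p \<delta> g (interior R) x = A_functional p \<delta> f R x"
    using g(2)
  proof eventually_elim
    case (elim x)
    then show ?case
      by (intro A_functional_cong_AE[OF g(2) _ AE_mem_interior[OF R], symmetric])
  qed
  show ?thesis
    by (rule completion.measurable_cong_AE[OF m _ ae]) (simp only: space_borel UNIV_I)
qed

section \<open>Oscillation of f controlled by A(R,.)\<close>

text \<open>Hoelder's inequality against the constant 1 on S. Since |x - y| \<le> r there,
  multiplying by r powr (n + \<delta> * p) makes the kernel at least 1 off the diagonal, which
  brings in the functional. At y = x, where the quotient has the value 0, the difference f x - f y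
  is 0 as well.\<close>

lemma nn_integral_diff_le_A_functional:
  fixes f :: "real ^ 'n \<Rightarrow> real"
  assumes [measurable]: "f \<in> borel_measurable lebesgue" "R \<in> sets lebesgue"
    and S: "S \<in> lmeasurable" "S \<subseteq> R" "\<And>y. y \<in> S \<Longrightarrow> norm (x - y) \<le> r"
    and r: "0 \<le> r" and p: "1 \<le> p" and \<delta>: "0 \<le> \<delta>"
    and a: "A_functional p \<delta> f R x \<le> ennreal a" "0 \<le> a"
  shows "(\<integral>\<^sup>+y\<in>S. ennreal \<bar>f x - f y\<bar> \<partial>lebesgue)
    \<le> ennreal ((r powr (real CARD('n) + \<delta> * p) * a) powr (1 / p) * measure lebesgue S powr (1 - 1 / p))"
proof -
  define \<alpha> where "\<alpha> = real CARD('n) + \<delta> * p"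
  have \<alpha>: "\<alpha> > 0" using p \<delta> by (simp add: \<alpha>_def add_pos_nonneg)
  have [measurable]: "S \<in> sets lebesgue" using S by auto
  have [measurable]: "(\<lambda>y. norm (x - y)) \<in> borel_measurable lebesgue"
    by (intro measurable_completion) simp
  have "(\<integral>\<^sup>+y\<in>S. ennreal \<bar>f x - f y\<bar> \<partial>lebesgue)
      = (\<integral>\<^sup>+y. ennreal ((\<bar>f x - f y\<bar> powr p * indicator S y) powr (1 / p) * indicator S y powr (1 - 1 / p)) \<partial>lebesgue)"
    using p by (intro nn_integral_cong) (auto simp: powr_powr split: split_indicator)
  also have "\<dots> \<le> ennreal ((r powr \<alpha> * a) powr (1 / p) * measure lebesgue S powr (1 - 1 / p))"
  proof (rule nn_integral_Holder)
    have "(\<integral>\<^sup>+y. ennreal (\<bar>f x - f y\<bar> powr p * indicator S y) \<partial>lebesgue)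
      \<le> (\<integral>\<^sup>+y. ennreal (r powr \<alpha>) * (ennreal (\<bar>f x - f y\<bar> powr p / norm (x - y) powr \<alpha>) * indicator R y) \<partial>lebesgue)"
    proof (rule nn_integral_mono)
      fix y
      show "ennreal (\<bar>f x - f y\<bar> powr p * indicator S y)
        \<le> ennreal (r powr \<alpha>) * (ennreal (\<bar>f x - f y\<bar> powr p / norm (x - y) powr \<alpha>) * indicator R y)"
      proof (cases "y \<in> S \<and> y \<noteq> x")
        case True
        then have n: "norm (x - y) > 0" "norm (x - y) \<le> r" using S by auto
        have "\<bar>f x - f y\<bar> powr p * norm (x - y) powr \<alpha> \<le> \<bar>f x - f y\<bar> powr p * r powr \<alpha>"
          using n \<alpha> by (intro mult_left_mono powr_mono2) auto
        then have "\<bar>f x - f y\<bar> powr p \<le> r powr \<alpha> * (\<bar>f x - f y\<bar> powr p / norm (x - y) powr \<alpha>)"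
          using n by (simp add: field_simps)
        then show ?thesis using True S by (auto simp: ennreal_mult[symmetric] intro!: ennreal_leI)
      qed (use p in auto)
    qed
    also have "\<dots> = ennreal (r powr \<alpha>) * A_functional p \<delta> f R x"
      unfolding A_functional_def \<alpha>_def by (rule nn_integral_cmult) measurable
    also have "\<dots> \<le> ennreal (r powr \<alpha>) * ennreal a" by (intro mult_left_mono a) auto
    finally show "(\<integral>\<^sup>+y. ennreal (\<bar>f x - f y\<bar> powr p * indicator S y) \<partial>lebesgue) \<le> ennreal (r powr \<alpha> * a)"
      using a by (simp add: ennreal_mult)
    show "(\<integral>\<^sup>+y. ennreal (indicator S y) \<partial>lebesgue) \<le> ennreal (measure lebesgue S)"
      using S by (simp add: emeasure_eq_measure2 ennreal_indicator)
  qed (use p a in auto)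
  finally show ?thesis unfolding \<alpha>_def .
qed

text \<open>Used with c = f x for pointwise estimates and with c the average over a larger cell for
  consecutive averages. Keeping the measure as a factor on the left avoids a division in
  \<open>ennreal\<close>.\<close>

lemma abs_diff_average_le:
  assumes f: "set_integrable lebesgue P f" and P: "P \<in> lmeasurable"
  shows "ennreal (measure lebesgue P * \<bar>c - average P f\<bar>) \<le> (\<integral>\<^sup>+y\<in>P. ennreal \<bar>c - f y\<bar> \<partial>lebesgue)"
proof (cases "measure lebesgue P = 0")
  case False
  have c: "set_integrable lebesgue P (\<lambda>y. c)" using P by (auto simp: set_integrable_def fmeasurable_def intro!: integrable_real_indicator)
  have "measure lebesgue P * (c - average P f) = set_lebesgue_integral lebesgue P (\<lambda>y. c) - set_lebesgue_integral lebesgue P f"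
    using False P by (simp add: average_def set_lebesgue_integral_def algebra_simps)
  also have "\<dots> = set_lebesgue_integral lebesgue P (\<lambda>y. c - f y)"
    using f c by (simp add: set_integral_diff)
  finally have "measure lebesgue P * (c - average P f) = (\<integral>y. indicator P y * (c - f y) \<partial>lebesgue)"
    by (simp add: set_lebesgue_integral_def)
  from arg_cong[OF this, of abs]
  have eq: "measure lebesgue P * \<bar>c - average P f\<bar> = \<bar>\<integral>y. indicator P y * (c - f y) \<partial>lebesgue\<bar>"
    by (simp only: abs_mult abs_of_nonneg measure_nonneg)
  have i: "integrable lebesgue (\<lambda>y. indicator P y * (c - f y))"
    using set_integral_diff(1)[OF c f] by (simp add: set_integrable_def)
  have "ennreal \<bar>\<integral>y. indicator P y * (c - f y) \<partial>lebesgue\<bar> \<le> (\<integral>\<^sup>+y. ennreal (norm (indicator P y * (c - f y))) \<partial>lebesgue)"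
    using integral_norm_bound_ennreal[OF i] by simp
  also have "\<dots> = (\<integral>\<^sup>+y\<in>P. ennreal \<bar>c - f y\<bar> \<partial>lebesgue)"
    by (intro nn_integral_cong) (auto split: split_indicator)
  finally show ?thesis unfolding eq .
qed simp

section \<open>Homothetic copies of a rectangle\<close>

text \<open>The contraction is centred at x, not at the midpoint of R: for 0 < t \<le> 1 and any x
  in the convex set R, boundary points included, the copies are nested, contain x and stay in
  R.\<close>

definition homothety :: "'a::real_vector \<Rightarrow> real \<Rightarrow> 'a set \<Rightarrow> 'a set"
  where "homothety x t R = (\<lambda>y. t *\<^sub>R y + (1 - t) *\<^sub>R x) ` R"

lemma homothety_1 [simp]: "homothety x 1 R = R"
  by (simp add: homothety_def)

lemma mem_homothety: "x \<in> R \<Longrightarrow> x \<in> homothety x t R"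
  unfolding homothety_def by (rule image_eqI[of _ _ x]) (auto simp: algebra_simps)

lemma homothety_mono:
  assumes R: "convex R" "x \<in> R" and t: "0 \<le> s" "s \<le> t" "0 < t"
  shows "homothety x s R \<subseteq> homothety x t R"
proof
  fix z assume "z \<in> homothety x s R"
  then obtain y where y: "y \<in> R" "z = s *\<^sub>R y + (1 - s) *\<^sub>R x" by (auto simp: homothety_def)
  have "(s / t) *\<^sub>R y + (1 - s / t) *\<^sub>R x \<in> R"
    using R y t by (intro convexD) auto
  moreover have "z = t *\<^sub>R ((s / t) *\<^sub>R y + (1 - s / t) *\<^sub>R x) + (1 - t) *\<^sub>R x"
    using t y by (simp add: algebra_simps)
  ultimately show "z \<in> homothety x t R" unfolding homothety_def by blast
qed

lemma measure_homothety:
  fixes R :: "(real ^ 'n) set"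
  assumes "0 \<le> t"
  shows "measure lebesgue (homothety x t R) = t ^ CARD('n) * measure lebesgue R"
  using measure_lebesgue_affine[of t "(1 - t) *\<^sub>R x" R] assms by (simp add: homothety_def)

lemma norm_diff_homothety_le:
  fixes R :: "'a::euclidean_space set"
  assumes "bounded R" "0 \<le> t" "y \<in> homothety x t R" "z \<in> homothety x t R"
  shows "norm (y - z) \<le> t * diameter R"
proof -
  obtain y' z' where *: "y' \<in> R" "z' \<in> R" "y = t *\<^sub>R y' + (1 - t) *\<^sub>R x" "z = t *\<^sub>R z' + (1 - t) *\<^sub>R x"
    using assms by (auto simp: homothety_def)
  then have "norm (y - z) = t * dist y' z'"
    using assms by (simp add: dist_norm scaleR_diff_right[symmetric])
  then show ?thesis
    using diameter_bounded_bound[OF assms(1) *(1,2)] assms by (simp add: mult_left_mono)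
qed

lemma homothety_rectangles:
  fixes R :: "(real ^ 'n) set"
  assumes R: "R \<in> rectangles" and t: "0 < t"
  shows "homothety x t R \<in> rectangles"
proof -
  from R obtain I :: "'n \<Rightarrow> real set" where
    I: "\<forall>i. is_interval (I i) \<and> bounded (I i) \<and> interior (I i) \<noteq> {}"
    and R: "R = {x. \<forall>i. x $ i \<in> I i}"
    unfolding rectangles_def mem_Collect_eq by (elim exE conjE)
  define J where "J i = (\<lambda>u. (1 - t) * x $ i + t * u) ` I i" for i
  have J: "J i = (\<lambda>v. (1 - t) * x $ i + v) ` ((\<lambda>u. t *\<^sub>R u) ` I i)" for i
    by (auto simp: J_def image_image)
  have "is_interval (J i) \<and> bounded (J i) \<and> interior (J i) \<noteq> {}" for i
  proof (intro conjI)
    have "is_interval (I i)" "bounded (I i)" "interior (I i) \<noteq> {}" using I by auto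
    then show "is_interval (J i)" "bounded (J i)" "interior (J i) \<noteq> {}"
      unfolding J is_interval_convex_1 using t interior_injective_linear_image[of "(*\<^sub>R) t" "I i"]
      by (auto intro!: convex_translation convex_scaling bounded_translation bounded_scaling
          simp: interior_translation linear_scale_self inj_on_def simp del: real_scaleR_def)
  qed
  moreover have "homothety x t R = {z. \<forall>i. z $ i \<in> J i}"
  proof (intro set_eqI iffI)
    fix z assume "z \<in> homothety x t R"
    then show "z \<in> {z. \<forall>i. z $ i \<in> J i}"
      by (auto simp: homothety_def R J_def)
  next
    fix z assume "z \<in> {z. \<forall>i. z $ i \<in> J i}"
    then have z: "z $ i \<in> J i" for i by simp
    define y where "y = (\<chi> i. (z $ i - (1 - t) * x $ i) / t)"
    have "y $ i \<in> I i" for i using z[of i] t by (auto simp: J_def y_def)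
    moreover have "z = t *\<^sub>R y + (1 - t) *\<^sub>R x" using t by (simp add: vec_eq_iff y_def)
    ultimately show "z \<in> homothety x t R" by (auto simp: homothety_def R)
  qed
  ultimately show ?thesis
    unfolding rectangles_def mem_Collect_eq by (intro exI[of _ J] conjI allI) simp_all
qed

section \<open>Rigidity for \<delta> > 1\<close>

lemma nn_integral_lborel_affine:
  fixes h :: "'a::euclidean_space \<Rightarrow> ennreal"
  assumes [measurable]: "h \<in> borel_measurable borel" and c: "c \<noteq> 0"
  shows "(\<integral>\<^sup>+x. h x \<partial>lborel) = ennreal (\<bar>c\<bar> ^ DIM('a)) * (\<integral>\<^sup>+x. h (t + c *\<^sub>R x) \<partial>lborel)"
proof -
  have "(\<integral>\<^sup>+x. h x \<partial>lborel) = (\<integral>\<^sup>+x. h x \<partial>density (distr lborel borel (\<lambda>x. t + c *\<^sub>R x)) (\<lambda>_. \<bar>c\<bar> ^ DIM('a)))"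
    using lborel_affine[OF c, of t] by simp
  also have "\<dots> = ennreal (\<bar>c\<bar> ^ DIM('a)) * (\<integral>\<^sup>+x. h (t + c *\<^sub>R x) \<partial>lborel)"
    by (simp add: nn_integral_density nn_integral_distr nn_integral_cmult)
  finally show ?thesis .
qed

text \<open>Any single point x of R with the inner property supplies the constant. If there is none,
  the assumption makes R null and every constant will do.\<close>

lemma AE_const_on:
  assumes "AE x in M. x \<in> R \<longrightarrow> (AE y in M. y \<in> R \<longrightarrow> f y = f x)"
  shows "\<exists>c. AE x in M. x \<in> R \<longrightarrow> f x = c"
proof (cases "\<exists>x\<in>R. AE y in M. y \<in> R \<longrightarrow> f y = f x")
  case False
  with assms have "AE x in M. x \<notin> R" by (auto elim: eventually_mono)
  then show ?thesis by (auto elim: eventually_mono)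
qed blast

text \<open>Comparing \<open>f x\<close> and \<open>f y\<close> through their midpoint bounds the mean oscillation at scale
  \<open>\<epsilon>\<close> by \<open>2 ^ (n + 1)\<close> times the one at scale \<open>\<epsilon> / 2\<close>; since the latter is
  \<open>O(\<epsilon> powr (n + \<delta>))\<close>, it vanishes when \<open>\<delta> > 1\<close>.\<close>

lemma A_functional_const_borel:
  fixes f :: "real ^ 'n \<Rightarrow> real"
  assumes f [measurable]: "f \<in> borel_measurable borel" and R [measurable]: "R \<in> sets borel"
    and cvx: "convex R" and bdd: "bounded R" and p: "1 \<le> p" and \<delta>: "1 < \<delta>"
    and fin: "AE x in lborel. x \<in> R \<longrightarrow> A_functional p \<delta> f R x < top"
    and M: "(\<integral>\<^sup>+x\<in>R. ennreal (enn2real (A_functional p \<delta> f R x) powr (1 / p)) \<partial>lborel) \<le> ennreal M" "0 \<le> M"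
  shows "AE x in lborel. x \<in> R \<longrightarrow> (AE y in lborel. y \<in> R \<longrightarrow> f y = f x)"
proof -
  define n where "n = CARD('n)"
  define F where "F \<epsilon> x y = ennreal \<bar>f x - f y\<bar> * (indicator R x * indicator R y * indicator {..\<epsilon>} (norm (x - y)))"
    for \<epsilon> :: real and x y :: "real ^ 'n"
  define G where "G \<epsilon> = (\<integral>\<^sup>+x. \<integral>\<^sup>+y. F \<epsilon> x y \<partial>lborel \<partial>lborel)" for \<epsilon>
  have F_meas [measurable (raw)]: "(\<lambda>u. F \<epsilon> (a u) (b u)) \<in> borel_measurable N"
    if [measurable]: "a \<in> borel_measurable N" "b \<in> borel_measurable N" for \<epsilon> a b and N :: "'z measure"
    unfolding F_def by measurable
  have half: "G \<epsilon> \<le> ennreal (2 * 2 ^ n) * G (\<epsilon> / 2)" for \<epsilon>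
  proof -
    let ?m = "\<lambda>x y :: real ^ 'n. (1 / 2) *\<^sub>R x + (1 / 2) *\<^sub>R y"
    have pt: "F \<epsilon> x y \<le> F (\<epsilon> / 2) x (?m x y) + F (\<epsilon> / 2) (?m x y) y" for x y
    proof (cases "x \<in> R \<and> y \<in> R \<and> norm (x - y) \<le> \<epsilon>")
      case True
      then have m: "?m x y \<in> R" using convexD[OF cvx, of x y "1/2" "1/2"] by simp
      have "x - ?m x y = (1 / 2) *\<^sub>R (x - y)" "?m x y - y = (1 / 2) *\<^sub>R (x - y)"
        by (simp_all add: vec_eq_iff field_simps)
      then have n: "norm (x - ?m x y) = norm (x - y) / 2" "norm (?m x y - y) = norm (x - y) / 2"
        by simp_all
      have "\<bar>f x - f y\<bar> \<le> \<bar>f x - f (?m x y)\<bar> + \<bar>f (?m x y) - f y\<bar>" by simp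
      from ennreal_leI[OF this]
      have "ennreal \<bar>f x - f y\<bar> \<le> ennreal \<bar>f x - f (?m x y)\<bar> + ennreal \<bar>f (?m x y) - f y\<bar>"
        by (simp only: ennreal_plus abs_ge_zero)
      then show ?thesis using True m unfolding F_def n by simp
    next
      case False
      then have "F \<epsilon> x y = 0" unfolding F_def by (auto split: split_indicator)
      then show ?thesis by simp
    qed
    \<comment> \<open>The map sending z to the midpoint of x and z is a homothety of ratio 1/2, so
      substituting it costs 2 ^ n. With one such term for each half of the segment, the factor is 2
      * 2 ^ n.\<close>
    have aff: "(\<integral>\<^sup>+z. h (?m x z) \<partial>lborel) = ennreal (2 ^ n) * (\<integral>\<^sup>+z. h z \<partial>lborel)"
      if [measurable]: "h \<in> borel_measurable borel" for h x
    proof -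
      have "(\<integral>\<^sup>+z. h z \<partial>lborel) = ennreal ((1 / 2) ^ n) * (\<integral>\<^sup>+z. h (?m x z) \<partial>lborel)"
        using nn_integral_lborel_affine[of h "1 / 2" "(1 / 2) *\<^sub>R x"] by (simp add: n_def)
      then have "ennreal (2 ^ n) * (\<integral>\<^sup>+z. h z \<partial>lborel) = (ennreal (2 ^ n) * ennreal ((1 / 2) ^ n)) * (\<integral>\<^sup>+z. h (?m x z) \<partial>lborel)"
        by (simp only: mult.assoc)
      also have "ennreal (2 ^ n) * ennreal ((1 / 2) ^ n) = 1"
        by (subst ennreal_mult[symmetric]) (simp_all add: power_mult_distrib[symmetric])
      finally show ?thesis by simp
    qed
    have "G \<epsilon> \<le> (\<integral>\<^sup>+x. \<integral>\<^sup>+y. F (\<epsilon> / 2) x (?m x y) + F (\<epsilon> / 2) (?m x y) y \<partial>lborel \<partial>lborel)"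
      unfolding G_def by (intro nn_integral_mono pt)
    also have "\<dots> = (\<integral>\<^sup>+x. \<integral>\<^sup>+y. F (\<epsilon> / 2) x (?m x y) \<partial>lborel \<partial>lborel)
        + (\<integral>\<^sup>+x. \<integral>\<^sup>+y. F (\<epsilon> / 2) (?m x y) y \<partial>lborel \<partial>lborel)"
      by (simp add: nn_integral_add)
    also have "(\<integral>\<^sup>+x. \<integral>\<^sup>+y. F (\<epsilon> / 2) x (?m x y) \<partial>lborel \<partial>lborel) = ennreal (2 ^ n) * G (\<epsilon> / 2)"
      unfolding G_def by (subst aff) (simp_all add: nn_integral_cmult)
    \<comment> \<open>In the second half the substitution has to be made in x while y stays fixed,
      hence the change in the order of integration.\<close>
    also have "(\<integral>\<^sup>+x. \<integral>\<^sup>+y. F (\<epsilon> / 2) (?m x y) y \<partial>lborel \<partial>lborel)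
        = (\<integral>\<^sup>+y. \<integral>\<^sup>+x. F (\<epsilon> / 2) (?m y x) y \<partial>lborel \<partial>lborel)"
      by (subst lborel_pair.Fubini') (simp_all add: add.commute)
    also have "\<dots> = ennreal (2 ^ n) * (\<integral>\<^sup>+y. \<integral>\<^sup>+x. F (\<epsilon> / 2) x y \<partial>lborel \<partial>lborel)"
    proof -
      have "(\<integral>\<^sup>+x. F (\<epsilon> / 2) (?m y x) y \<partial>lborel) = ennreal (2 ^ n) * (\<integral>\<^sup>+x. F (\<epsilon> / 2) x y \<partial>lborel)" for y
        by (rule aff[of "\<lambda>z. F (\<epsilon> / 2) z y"]) simp
      then show ?thesis by (simp add: nn_integral_cmult)
    qed
    also have "(\<integral>\<^sup>+y. \<integral>\<^sup>+x. F (\<epsilon> / 2) x y \<partial>lborel \<partial>lborel) = G (\<epsilon> / 2)"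
      unfolding G_def by (rule lborel_pair.Fubini') simp
    finally show ?thesis
      using ennreal_plus[of "2 ^ n" "2 ^ n"] by (simp only: mult_2 distrib_right zero_le_power zero_le_numeral)
  qed
  have halves: "G d \<le> ennreal ((2 * 2 ^ n) ^ k) * G (d / 2 ^ k)" for d k
  proof (induction k)
    case (Suc k)
    have "G d \<le> ennreal ((2 * 2 ^ n) ^ k) * G (d / 2 ^ k)" by (rule Suc.IH)
    also have "\<dots> \<le> ennreal ((2 * 2 ^ n) ^ k) * (ennreal (2 * 2 ^ n) * G (d / 2 ^ k / 2))"
      by (rule mult_left_mono[OF half]) simp
    also have "\<dots> = ennreal ((2 * 2 ^ n) ^ k * (2 * 2 ^ n)) * G (d / 2 ^ k / 2)"
      by (subst ennreal_mult) (simp_all only: mult.assoc zero_le_power zero_le_mult_iff zero_le_numeral simp_thms)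
    finally show ?case by (simp only: power_Suc2 divide_divide_eq_left)
  qed simp
  define c where "c = measure lebesgue (cball (0 :: real ^ 'n) 1)"
  define C where "C = c powr (1 - 1 / p) * M"
  have C0: "0 \<le> C" using M by (simp add: C_def)
  have [measurable]: "A_functional p \<delta> f R \<in> borel_measurable borel"
    by (rule A_functional_measurable_borel[OF f R])
  \<comment> \<open>The kernel contributes \<epsilon> powr (n / p + \<delta>) and the volume of the
    ball \<epsilon> powr (n * (1 - 1 / p)); the exponents add up to n + \<delta>.\<close>
  have small: "G \<epsilon> \<le> ennreal (\<epsilon> powr (real n + \<delta>) * C)" if \<epsilon>: "0 < \<epsilon>" for \<epsilon>
  proof -
    let ?a = "\<lambda>x. enn2real (A_functional p \<delta> f R x)"
    have cb: "measure lebesgue (cball x \<epsilon>) = \<epsilon> ^ n * c" for x :: "real ^ 'n"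
    proof -
      have "cball x \<epsilon> = (\<lambda>y. \<epsilon> *\<^sub>R y + x) ` cball 0 1"
      proof (intro set_eqI iffI)
        fix y assume "y \<in> cball x \<epsilon>"
        then have "(1 / \<epsilon>) *\<^sub>R (y - x) \<in> cball 0 1"
          using \<epsilon> by (simp add: dist_norm norm_minus_commute)
        moreover have "y = \<epsilon> *\<^sub>R ((1 / \<epsilon>) *\<^sub>R (y - x)) + x" using \<epsilon> by simp
        ultimately show "y \<in> (\<lambda>y. \<epsilon> *\<^sub>R y + x) ` cball 0 1" by (rule rev_image_eqI)
      qed (use \<epsilon> in \<open>auto simp: dist_norm\<close>)
      then show ?thesis
        using measure_lebesgue_affine[of \<epsilon> x "cball (0 :: real ^ 'n) 1"] \<epsilon> by (simp add: c_def n_def)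
    qed
    have "G \<epsilon> \<le> (\<integral>\<^sup>+x. ennreal (\<epsilon> powr (real n + \<delta>) * c powr (1 - 1 / p)) * (ennreal (?a x powr (1 / p)) * indicator R x) \<partial>lborel)"
      unfolding G_def
    proof (intro nn_integral_mono_AE, use fin in eventually_elim)
      fix x assume fin: "x \<in> R \<longrightarrow> A_functional p \<delta> f R x < top"
      show "(\<integral>\<^sup>+y. F \<epsilon> x y \<partial>lborel) \<le> ennreal (\<epsilon> powr (real n + \<delta>) * c powr (1 - 1 / p)) * (ennreal (?a x powr (1 / p)) * indicator R x)"
      proof (cases "x \<in> R")
        case False
        then show ?thesis by (simp add: F_def)
      next
        case True
        define S where "S = R \<inter> cball x \<epsilon>"
        have S: "S \<in> lmeasurable" "S \<subseteq> R" "\<And>y. y \<in> S \<Longrightarrow> norm (x - y) \<le> \<epsilon>"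
          unfolding S_def using cvx bdd
          by (auto simp: dist_norm intro!: measurable_convex convex_Int bounded_Int)
        have "measure lebesgue S \<le> \<epsilon> ^ n * c"
          unfolding cb[symmetric, of x] using S by (intro measure_mono_fmeasurable) (auto simp: S_def)
        then have mS: "measure lebesgue S \<le> \<epsilon> powr n * c" using \<epsilon> by (simp add: powr_realpow)
        have "(\<integral>\<^sup>+y. F \<epsilon> x y \<partial>lborel) = (\<integral>\<^sup>+y\<in>S. ennreal \<bar>f x - f y\<bar> \<partial>lebesgue)"
          unfolding nn_integral_completion using True
          by (intro nn_integral_cong) (auto simp: F_def S_def dist_norm split: split_indicator)
        also have "\<dots> \<le> ennreal ((\<epsilon> powr (real CARD('n) + \<delta> * p) * ?a x) powr (1 / p) * measure lebesgue S powr (1 - 1 / p))"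
          using True fin \<epsilon> p \<delta>
          by (intro nn_integral_diff_le_A_functional[OF _ _ S]) (auto intro: measurable_completion)
        also have "\<dots> \<le> ennreal (\<epsilon> powr (real n + \<delta>) * c powr (1 - 1 / p) * ?a x powr (1 / p))"
        proof (rule ennreal_leI)
          have "(\<epsilon> powr (real CARD('n) + \<delta> * p) * ?a x) powr (1 / p) * measure lebesgue S powr (1 - 1 / p)
            \<le> (\<epsilon> powr (real n + \<delta> * p) * ?a x) powr (1 / p) * (\<epsilon> powr n * c) powr (1 - 1 / p)"
            unfolding n_def[symmetric] using mS p by (intro mult_left_mono powr_mono2) auto
          also have "\<dots> = \<epsilon> powr ((real n + \<delta> * p) * (1 / p)) * \<epsilon> powr (n * (1 - 1 / p)) * c powr (1 - 1 / p) * ?a x powr (1 / p)"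
            using \<epsilon> by (simp add: powr_mult powr_powr c_def)
          also have "\<epsilon> powr ((real n + \<delta> * p) * (1 / p)) * \<epsilon> powr (n * (1 - 1 / p)) = \<epsilon> powr (real n + \<delta>)"
            unfolding powr_add[symmetric] using p by (simp add: add_divide_distrib right_diff_distrib add.commute)
          finally show "(\<epsilon> powr (real CARD('n) + \<delta> * p) * ?a x) powr (1 / p) * measure lebesgue S powr (1 - 1 / p)
            \<le> \<epsilon> powr (real n + \<delta>) * c powr (1 - 1 / p) * ?a x powr (1 / p)" .
        qed
        finally show ?thesis using True by (simp add: ennreal_mult)
      qed
    qed
    also have "\<dots> = ennreal (\<epsilon> powr (real n + \<delta>) * c powr (1 - 1 / p)) * (\<integral>\<^sup>+x\<in>R. ennreal (?a x powr (1 / p)) \<partial>lborel)"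
      by (intro nn_integral_cmult) measurable
    also have "\<dots> \<le> ennreal (\<epsilon> powr (real n + \<delta>) * c powr (1 - 1 / p)) * ennreal M"
      by (intro mult_left_mono M) simp
    also have "\<dots> = ennreal (\<epsilon> powr (real n + \<delta>) * c powr (1 - 1 / p) * M)"
      using M by (intro ennreal_mult[symmetric]) simp_all
    finally show ?thesis by (simp only: C_def mult.assoc)
  qed
  \<comment> \<open>At scale \<open>d\<close> the cut-off in \<open>F\<close> admits all pairs of
    points of R, so G d = 0 makes f constant almost everywhere; adding 1 keeps \<open>d\<close>
    positive.\<close>
  define d where "d = diameter R + 1"
  have d: "d > 0" using diameter_ge_0[OF bdd] by (simp add: d_def)
  \<comment> \<open>k halvings cost 2 powr (k * (n + 1)), while \<open>small\<close> at scale d / 2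
    ^ k gains 2 powr (-k * (n + \<delta>)). The product tends to 0 because \<delta> > 1.\<close>
  have bound: "G d \<le> ennreal (d powr (real n + \<delta>) * C * (2 powr (1 - \<delta>)) ^ k)" for k
  proof -
    have "G d \<le> ennreal ((2 * 2 ^ n) ^ k) * G (d / 2 ^ k)" by (rule halves)
    also have "\<dots> \<le> ennreal ((2 * 2 ^ n) ^ k) * ennreal ((d / 2 ^ k) powr (real n + \<delta>) * C)"
      using d by (intro mult_left_mono small) simp_all
    also have "ennreal ((2 * 2 ^ n) ^ k) * ennreal ((d / 2 ^ k) powr (real n + \<delta>) * C)
        = ennreal ((2 * 2 ^ n) ^ k * ((d / 2 ^ k) powr (real n + \<delta>) * C))"
      using C0 by (intro ennreal_mult[symmetric]) simp_all
    also have "(2 * 2 ^ n) ^ k * ((d / 2 ^ k) powr (real n + \<delta>) * C)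
        = d powr (real n + \<delta>) * C * (2 powr (1 - \<delta>)) ^ k"
    proof -
      have 1: "(2 * 2 ^ n :: real) ^ k = 2 powr ((1 + real n) * k)"
      proof -
        have "(2 * 2 ^ n :: real) ^ k = 2 ^ (Suc n * k)" by (simp only: power_mult power_Suc)
        also have "\<dots> = 2 powr real (Suc n * k)" by (rule powr_realpow[symmetric]) simp
        also have "real (Suc n * k) = (1 + real n) * real k" by (simp add: algebra_simps)
        finally show ?thesis .
      qed
      have 2: "(2 powr (1 - \<delta>)) ^ k = 2 powr ((1 - \<delta>) * k)"
        using powr_powr[of 2 "1 - \<delta>" "real k"] powr_realpow[of "2 powr (1 - \<delta>)" k] by simp
      have 3: "(d / 2 ^ k) powr (real n + \<delta>) = d powr (real n + \<delta>) * 2 powr (- (k * (real n + \<delta>)))"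
        using d powr_realpow[of 2 k] powr_powr[of 2 "real k" "real n + \<delta>"]
        by (simp add: powr_divide powr_minus_divide)
      have "2 powr ((1 + real n) * k) * 2 powr (- (k * (real n + \<delta>))) = 2 powr ((1 - \<delta>) * k)"
        unfolding powr_add[symmetric] by (simp add: algebra_simps)
      then show ?thesis unfolding 1 2 3 by (simp add: mult_ac)
    qed
    finally show ?thesis .
  qed
  have "(\<lambda>k. ennreal (d powr (real n + \<delta>) * C * (2 powr (1 - \<delta>)) ^ k)) \<longlonglongrightarrow> ennreal (d powr (real n + \<delta>) * C * 0)"
    using \<delta> powr_less_mono[of "1 - \<delta>" 0 2] by (intro tendsto_ennrealI tendsto_mult_left LIMSEQ_power_zero) simp
  then have "G d \<le> 0"
    using bound by (simp only: mult_zero_right ennreal_0) (rule LIMSEQ_le_const, assumption, blast)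
  then have "AE x in lborel. (\<integral>\<^sup>+y. F d x y \<partial>lborel) = 0"
    unfolding G_def by (subst nn_integral_0_iff_AE[symmetric]) auto
  then show ?thesis
  proof eventually_elim
    case (elim x)
    then have "AE y in lborel. F d x y = 0"
      by (subst (asm) nn_integral_0_iff_AE) auto
    then show ?case
    proof (intro impI, eventually_elim)
      case (elim y)
      show "y \<in> R \<longrightarrow> f y = f x"
      proof
        assume "y \<in> R"
        then have "norm (x - y) \<le> d"
          using diameter_bounded_bound[OF bdd \<open>x \<in> R\<close>, of y] by (simp add: d_def dist_norm)
        then show "f y = f x"
          using elim \<open>x \<in> R\<close> \<open>y \<in> R\<close> by (simp add: F_def)
      qed
    qed
  qed
qed

text \<open>Transfer from Borel data to Lebesgue measurable f. The hypothesis concerns the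
  unweighted integral of A powr (1 / p) because this is what the A_p condition yields from a finite
  weighted integral of A.\<close>

lemma A_functional_const:
  fixes f :: "real ^ 'n \<Rightarrow> real"
  assumes f: "f \<in> borel_measurable lebesgue"
    and cvx: "convex R" and bdd: "bounded R" and p: "1 \<le> p" and \<delta>: "1 < \<delta>"
    and fin: "AE x in lebesgue. x \<in> R \<longrightarrow> A_functional p \<delta> f R x < top"
    and M: "(\<integral>\<^sup>+x\<in>R. ennreal (enn2real (A_functional p \<delta> f R x) powr (1 / p)) \<partial>lebesgue) \<le> ennreal M" "0 \<le> M"
  shows "\<exists>c. AE x in lebesgue. x \<in> R \<longrightarrow> f x = c"
proof -
  obtain g where g: "g \<in> borel_measurable borel" "AE x in lebesgue. f x = g x"
    using borel_version[OF f] .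
  define S where "S = interior R"
  have S: "S \<in> sets borel" "convex S" "bounded S"
    using cvx bdd by (auto simp: S_def convex_interior bounded_interior)
  have RS: "AE x in lebesgue. x \<in> R \<longleftrightarrow> x \<in> S"
    using AE_mem_interior[OF cvx] by (simp add: S_def)
  have eq: "AE x in lebesgue. A_functional p \<delta> f R x = A_functional p \<delta> g S x"
    using g(2) by eventually_elim (rule A_functional_cong_AE[OF g(2) _ RS])
  have "AE x in lborel. x \<in> S \<longrightarrow> (AE y in lborel. y \<in> S \<longrightarrow> g y = g x)"
  proof (rule A_functional_const_borel[OF g(1) S p \<delta> _ _ M(2)])
    show "AE x in lborel. x \<in> S \<longrightarrow> A_functional p \<delta> g S x < top"
    proof -
      have "AE x in lebesgue. x \<in> S \<longrightarrow> A_functional p \<delta> g S x < top"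
        using fin RS eq by eventually_elim auto
      then show ?thesis by (simp add: AE_completion_iff)
    qed
    have "(\<integral>\<^sup>+x\<in>S. ennreal (enn2real (A_functional p \<delta> g S x) powr (1 / p)) \<partial>lebesgue)
      = (\<integral>\<^sup>+x\<in>R. ennreal (enn2real (A_functional p \<delta> f R x) powr (1 / p)) \<partial>lebesgue)"
      by (intro nn_integral_cong_AE, use RS eq in eventually_elim) (auto split: split_indicator)
    then show "(\<integral>\<^sup>+x\<in>S. ennreal (enn2real (A_functional p \<delta> g S x) powr (1 / p)) \<partial>lborel) \<le> ennreal M"
      using M by (simp add: nn_integral_completion)
  qed
  then obtain c where "AE x in lborel. x \<in> S \<longrightarrow> g x = c"
    using AE_const_on[of S g lborel] by auto
  then have "AE x in lebesgue. x \<in> S \<longrightarrow> g x = c" by (rule AE_completion)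
  then have "AE x in lebesgue. x \<in> R \<longrightarrow> f x = c"
    using RS g(2) by eventually_elim auto
  then show ?thesis ..
qed

section \<open>Choice of the scale\<close>

text \<open>Optimising over the scale \<open>2 ^ -k\<close>: the two terms balance when \<open>2 powr (k * n * q)\<close> is
  comparable with \<open>G / K\<close>, where \<open>G = a / N\<close>.  The exponent is the one for which the loss
  \<open>K powr \<sigma>\<close> stays bounded by \<open>exp 1\<close>.\<close>

lemma scale_optimization:
  fixes X D N K L a c q p \<delta> n \<sigma> :: real
  assumes n: "1 \<le> n" and p: "0 < p" and q: "1 \<le> q" and \<delta>: "0 < \<delta>" "\<delta> \<le> 1"
    and K: "1 \<le> K" and L: "1 \<le> L" and N: "0 < N" and a: "0 \<le> a" and D: "0 \<le> D" and c: "0 \<le> c"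
    and \<sigma>: "\<sigma> = \<delta> / n * (1 / (q + ln K))"
    and X0: "X \<le> D * a powr (1 / p)"
    and X: "\<And>k :: nat. X \<le> D * 2 powr (- (k * \<delta>)) * a powr (1 / p)
        + c * D * (L * N * K) powr (1 / p) * 2 powr (k * (n * q / p - \<delta>))"
  shows "X \<le> 2 * (1 + c) * exp 1 * D * L powr (1 / p) * N powr (1 / p) * (a / N) powr (1 / p - \<sigma>)"
proof -
  define G where "G = a / N"
  have G0: "0 \<le> G" using a N by (simp add: G_def)
  have aG: "a powr (1 / p) = N powr (1 / p) * G powr (1 / p)"
    using a N by (simp add: G_def powr_divide)
  have lnK: "0 \<le> ln K" using K by simp
  have \<sigma>0: "0 \<le> \<sigma>" using \<sigma> \<delta> n q lnK by simp
  have "\<sigma> * ln K \<le> 1"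
  proof -
    have "ln K / (q + ln K) \<le> 1" using q lnK by (simp add: divide_le_eq)
    moreover have "\<delta> / n \<le> 1" using \<delta> n by (simp add: divide_le_eq)
    moreover have "0 \<le> \<delta> / n" "0 \<le> ln K / (q + ln K)" using \<delta> n q lnK by auto
    ultimately have "\<delta> / n * (ln K / (q + ln K)) \<le> 1 * 1" by (intro mult_mono) auto
    then show ?thesis by (simp add: \<sigma>)
  qed
  then have K\<sigma>: "K powr \<sigma> \<le> exp 1" using K by (simp add: powr_def)
  \<comment> \<open>This lets 2 powr (k * \<delta>) absorb H powr \<sigma> once H is comparable with
    2 powr (k * n * q).\<close>
  have nq\<sigma>: "n * q * \<sigma> \<le> \<delta>"
  proof -
    have "n * q * \<sigma> = \<delta> * (q / (q + ln K))" using n by (simp add: \<sigma>)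
    also have "\<dots> \<le> \<delta> * 1" using q lnK \<delta> by (intro mult_left_mono) (auto simp: divide_le_eq)
    finally show ?thesis by simp
  qed
  have L1: "1 \<le> L powr (1 / p)" using L p by (simp add: ge_one_powr_ge_zero)
  let ?B = "D * L powr (1 / p) * N powr (1 / p)"
  have B0: "0 \<le> ?B" using D by simp
  have DB: "D * N powr (1 / p) \<le> ?B"
    using D L1 mult_left_mono[of 1 "L powr (1 / p)" "D * N powr (1 / p)"] by (simp add: mult_ac)
  have split: "G powr (1 / p) = G powr (1 / p - \<sigma>) * G powr \<sigma>"
    by (simp add: powr_add[symmetric])
  have "X \<le> 2 * (1 + c) * exp 1 * ?B * G powr (1 / p - \<sigma>)"
  proof (cases "G \<le> K")
    \<comment> \<open>The balancing scale is not finer than R itself, so no shrinking is done: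
      \<open>X0\<close> suffices, since G powr \<sigma> \<le> K powr \<sigma> \<le> exp 1.\<close>
    case True
    have "G powr \<sigma> \<le> exp 1" using powr_mono2[OF \<sigma>0 G0 True] K\<sigma> by linarith
    then have "G powr (1 / p) \<le> G powr (1 / p - \<sigma>) * exp 1"
      unfolding split by (intro mult_left_mono) auto
    then have "D * N powr (1 / p) * G powr (1 / p) \<le> D * N powr (1 / p) * (G powr (1 / p - \<sigma>) * exp 1)"
      using D by (intro mult_left_mono) auto
    then have "X \<le> D * N powr (1 / p) * (G powr (1 / p - \<sigma>) * exp 1)"
      using X0 unfolding aG mult.assoc by (rule order_trans[rotated])
    also have "\<dots> \<le> ?B * (G powr (1 / p - \<sigma>) * exp 1)"
      by (intro mult_right_mono DB) auto
    also have "\<dots> = 1 * (exp 1 * ?B * G powr (1 / p - \<sigma>))" by simp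
    also have "\<dots> \<le> (2 * (1 + c)) * (exp 1 * ?B * G powr (1 / p - \<sigma>))"
      using B0 c by (intro mult_right_mono) auto
    finally show ?thesis by (simp only: mult.assoc)
  next
    case False
    define H where "H = G / K"
    have H: "1 < H" using False K by (simp add: H_def)
    have GK: "G = K * H" using K by (simp add: H_def)
    \<comment> \<open>The largest k with 2 powr (k * n * q) \<le> H. The upper bound on H makes the
      growing factor no larger than the decaying one (\<open>grow\<close>); maximality of k controls
      the decaying one (\<open>decay\<close>).\<close>
    define k where "k = nat \<lfloor>log 2 H / (n * q)\<rfloor>"
    have nq: "0 < n * q" using n q by simp
    have "0 \<le> log 2 H / (n * q)" using H nq by simp
    then have "real k = of_int \<lfloor>log 2 H / (n * q)\<rfloor>" by (simp add: k_def)
    then have k: "real k \<le> log 2 H / (n * q)" "log 2 H / (n * q) \<le> real k + 1"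
      by linarith+
    then have "real k * (n * q) \<le> log 2 H" "log 2 H \<le> (real k + 1) * (n * q)"
      using nq by (simp_all only: pos_le_divide_eq pos_divide_le_eq)
    then have k1: "2 powr (k * (n * q)) \<le> H" and k2: "H \<le> 2 powr ((real k + 1) * (n * q))"
      using le_log_iff[of 2 H "real k * (n * q)"] log_le_iff[of 2 H "(real k + 1) * (n * q)"] H by simp_all
    have "H powr \<sigma> \<le> (2 powr ((real k + 1) * (n * q))) powr \<sigma>"
      using k2 H \<sigma>0 by (intro powr_mono2) auto
    also have "\<dots> = 2 powr ((real k + 1) * (n * q * \<sigma>))" by (simp add: powr_powr mult_ac)
    also have "\<dots> \<le> 2 powr ((real k + 1) * \<delta>)"
      using nq\<sigma> by (intro powr_mono mult_left_mono) auto
    also have "\<dots> = 2 powr (k * \<delta>) * 2 powr \<delta>" by (simp add: powr_add[symmetric] distrib_right)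
    \<comment> \<open>Rounding k down costs at most 2 powr \<delta> \<le> 2. This is the 2 in the
      final constant, next to 1 + c from adding the two terms and exp 1 from K powr
      \<sigma>.\<close>
    also have "\<dots> \<le> 2 powr (k * \<delta>) * 2"
      using powr_mono[of \<delta> 1 "2 :: real"] \<delta> by (intro mult_left_mono) auto
    finally have H\<sigma>: "H powr \<sigma> \<le> 2 powr (k * \<delta>) * 2" .
    have decay: "2 powr (- (k * \<delta>)) * G powr (1 / p) \<le> 2 * exp 1 * G powr (1 / p - \<sigma>)"
    proof -
      have "G powr \<sigma> = K powr \<sigma> * H powr \<sigma>" using K H by (simp add: GK powr_mult)
      also have "\<dots> \<le> exp 1 * (2 powr (k * \<delta>) * 2)" using K\<sigma> H\<sigma> by (intro mult_mono) auto
      finally have "2 powr (- (k * \<delta>)) * G powr \<sigma> \<le> 2 powr (- (k * \<delta>)) * (exp 1 * (2 powr (k * \<delta>) * 2))"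
        by (intro mult_left_mono) auto
      also have "\<dots> = 2 * exp 1" by (simp add: powr_minus)
      finally have "G powr (1 / p - \<sigma>) * (2 powr (- (k * \<delta>)) * G powr \<sigma>) \<le> G powr (1 / p - \<sigma>) * (2 * exp 1)"
        by (intro mult_left_mono) auto
      then show ?thesis unfolding split by (simp add: mult_ac)
    qed
    have grow: "K powr (1 / p) * 2 powr (k * (n * q / p - \<delta>)) \<le> 2 powr (- (k * \<delta>)) * G powr (1 / p)"
    proof -
      have "2 powr (k * (n * q / p - \<delta>)) = 2 powr (k * (n * q) * (1 / p)) * 2 powr (- (k * \<delta>))"
        unfolding powr_add[symmetric] by (simp add: right_diff_distrib)
      also have "2 powr (k * (n * q) * (1 / p)) \<le> H powr (1 / p)"
        using k1 p powr_mono2[of "1 / p" "2 powr (k * (n * q))" H] by (simp add: powr_powr)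
      finally have "2 powr (k * (n * q / p - \<delta>)) \<le> H powr (1 / p) * 2 powr (- (k * \<delta>))"
        by simp
      then have "K powr (1 / p) * 2 powr (k * (n * q / p - \<delta>)) \<le> K powr (1 / p) * (H powr (1 / p) * 2 powr (- (k * \<delta>)))"
        by (intro mult_left_mono) auto
      also have "\<dots> = 2 powr (- (k * \<delta>)) * G powr (1 / p)" using K H by (simp add: GK powr_mult mult_ac)
      finally show ?thesis .
    qed
    have "X \<le> (D * N powr (1 / p)) * (2 powr (- (k * \<delta>)) * G powr (1 / p))
        + c * ?B * (K powr (1 / p) * 2 powr (k * (n * q / p - \<delta>)))"
    proof -
      have "(L * N * K) powr (1 / p) = L powr (1 / p) * N powr (1 / p) * K powr (1 / p)"
        using L N K by (simp add: powr_mult)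
      then show ?thesis using X[of k] unfolding aG by (simp only: mult_ac)
    qed
    also have "\<dots> \<le> ?B * (2 powr (- (k * \<delta>)) * G powr (1 / p)) + c * ?B * (2 powr (- (k * \<delta>)) * G powr (1 / p))"
      using B0 c by (intro add_mono mult_right_mono[OF DB] mult_left_mono[OF grow]) simp_all
    also have "\<dots> = (1 + c) * ?B * (2 powr (- (k * \<delta>)) * G powr (1 / p))" by (simp add: distrib_right)
    also have "\<dots> \<le> (1 + c) * ?B * (2 * exp 1 * G powr (1 / p - \<sigma>))"
      using B0 c by (intro mult_left_mono decay) auto
    also have "\<dots> = 2 * (1 + c) * exp 1 * ?B * G powr (1 / p - \<sigma>)"
      by (simp only: mult_ac)
    finally show ?thesis .
  qed
  then show ?thesis by (simp add: G_def mult.assoc)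
qed

section \<open>Averages over shrinking rectangles\<close>

lemma homothety_subset: "convex R \<Longrightarrow> x \<in> R \<Longrightarrow> 0 \<le> t \<Longrightarrow> t \<le> 1 \<Longrightarrow> homothety x t R \<subseteq> R"
  using homothety_mono[of R x t 1] by simp

text \<open>A factor t powr (n / p) from the diameter cancels the one in |P| powr (1 / p), so the
  same quotient, formed from R, serves at every scale and only t powr \<delta> remains. The choice z
  = x ends the chain of averages; general z is needed to integrate over the cell.\<close>

lemma abs_diff_average_homothety_le:
  fixes f :: "real ^ 'n \<Rightarrow> real"
  assumes f: "locally_integrable f" and R: "R \<in> rectangles"
    and p: "1 \<le> p" and \<delta>: "0 \<le> \<delta>" and x: "x \<in> R" and t: "0 < t" "t \<le> 1"
    and z: "z \<in> homothety x t R" and a: "A_functional p \<delta> f R z = ennreal a" "0 \<le> a"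
  shows "\<bar>f z - average (homothety x t R) f\<bar>
    \<le> diameter R powr (real CARD('n) / p + \<delta>) / measure lebesgue R powr (1 / p) * t powr \<delta> * a powr (1 / p)"
proof -
  define n where "n = CARD('n)"
  define P where "P = homothety x t R"
  define v where "v = measure lebesgue P"
  note Rp = rectangles_properties[OF R]
  have "P \<in> rectangles" unfolding P_def using R t by (intro homothety_rectangles) auto
  note Pp = rectangles_properties[OF this]
  have PR: "P \<subseteq> R" unfolding P_def using Rp x t by (intro homothety_subset) auto
  have v: "v = t ^ n * measure lebesgue R" "v > 0"
    using Pp t by (simp_all add: v_def P_def measure_homothety n_def)
  have d0: "0 \<le> diameter R" using Rp by (simp add: diameter_ge_0)
  have "ennreal (v * \<bar>f z - average P f\<bar>) \<le> (\<integral>\<^sup>+y\<in>P. ennreal \<bar>f z - f y\<bar> \<partial>lebesgue)"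
    unfolding v_def using f Pp by (intro abs_diff_average_le locally_integrable_integrable_on) auto
  also have "\<dots> \<le> ennreal (((t * diameter R) powr (real CARD('n) + \<delta> * p) * a) powr (1 / p) * measure lebesgue P powr (1 - 1 / p))"
  proof (rule nn_integral_diff_le_A_functional[OF locally_integrable_measurable[OF f] _ Pp(3) PR _ _ p \<delta>])
    show "norm (z - y) \<le> t * diameter R" if "y \<in> P" for y
      using norm_diff_homothety_le[of R t z x y] Rp t z that by (simp add: P_def)
  qed (use a Rp t d0 in auto)
  finally have "v * \<bar>f z - average P f\<bar> \<le> ((t * diameter R) powr (real n + \<delta> * p) * a) powr (1 / p) * v powr (1 - 1 / p)"
    by (simp add: v_def n_def)
  also have "((t * diameter R) powr (real n + \<delta> * p) * a) powr (1 / p)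
      = (t * diameter R) powr ((real n + \<delta> * p) * (1 / p)) * a powr (1 / p)"
    using a d0 t by (simp add: powr_mult powr_powr)
  also have "(real n + \<delta> * p) * (1 / p) = real n / p + \<delta>" using p by (simp add: add_divide_distrib)
  also have "(t * diameter R) powr (real n / p + \<delta>) = t powr (n / p) * t powr \<delta> * diameter R powr (real n / p + \<delta>)"
    using t d0 by (simp add: powr_mult powr_add[symmetric])
  also have "v powr (1 - 1 / p) = v / v powr (1 / p)" using v by (simp add: powr_diff)
  also have "v powr (1 / p) = t powr (n / p) * measure lebesgue R powr (1 / p)"
    unfolding v using t Rp by (simp add: powr_mult powr_realpow[symmetric] powr_powr)
  finally have "v * \<bar>f z - average P f\<bar>
      \<le> v * (diameter R powr (real n / p + \<delta>) / measure lebesgue R powr (1 / p) * t powr \<delta> * a powr (1 / p))"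
    using t by (simp add: field_simps)
  from mult_left_le_imp_le[OF this v(2)] show ?thesis by (simp only: P_def n_def)
qed

text \<open>Integrate the pointwise bound over the cell P. The A_p test on P bounds the mean of A
  powr (1 / p) by (L * W * N / w(P)) powr (1 / p), and A_q on R bounds W / w(P) by K * t powr (-n *
  q).\<close>

lemma homothety_Poincare:
  fixes f w :: "real ^ 'n \<Rightarrow> real"
  assumes f: "locally_integrable f" and R: "R \<in> rectangles"
    and p: "1 \<le> p" and q: "1 \<le> q" and \<delta>: "0 \<le> \<delta>" and x: "x \<in> R" and t: "0 < t" "t \<le> 1"
    and w: "weight w" and K: "Ar_const q w = ennreal K" "0 \<le> K" and L: "Ar_const p w = ennreal L" "0 \<le> L"
    and W: "wmeasure w R = ennreal W" "0 < W" and N: "0 \<le> N"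
    and fin: "AE z in lebesgue. z \<in> R \<longrightarrow> A_functional p \<delta> f R z < top"
    and int: "(\<integral>\<^sup>+z\<in>R. A_functional p \<delta> f R z * ennreal (w z) \<partial>lebesgue) \<le> ennreal (W * N)"
  defines "D \<equiv> diameter R powr (real CARD('n) / p + \<delta>) / measure lebesgue R powr (1 / p)"
  shows "(\<integral>\<^sup>+z\<in>homothety x t R. ennreal \<bar>average (homothety x t R) f - f z\<bar> \<partial>lebesgue)
    \<le> ennreal (measure lebesgue (homothety x t R) * (D * (L * N * K) powr (1 / p) * t powr (\<delta> - real CARD('n) * q / p)))"
proof -
  define n where "n = CARD('n)"
  define P where "P = homothety x t R"
  define a where "a z = enn2real (A_functional p \<delta> f R z)" for z
  note Rp = rectangles_properties[OF R]
  have Pr: "P \<in> rectangles" unfolding P_def using R t by (intro homothety_rectangles) auto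
  note Pp = rectangles_properties[OF this]
  have PR: "P \<subseteq> R" unfolding P_def using Rp x t by (intro homothety_subset) auto
  have [measurable]: "P \<in> sets lebesgue" "R \<in> sets lebesgue" using Pp Rp by auto
  have [measurable]: "w \<in> borel_measurable lebesgue"
    using w by (auto simp: weight_def intro: locally_integrable_measurable)
  have [measurable]: "A_functional p \<delta> f R \<in> borel_measurable lebesgue"
    using locally_integrable_measurable[OF f] Rp(1) by (rule A_functional_measurable)
  have a_meas [measurable]: "a \<in> borel_measurable lebesgue" unfolding a_def by measurable
  have a0: "0 \<le> a z" for z by (simp add: a_def)
  have D0: "0 \<le> D" by (simp add: D_def)
  have aA: "AE z in lebesgue. z \<in> R \<longrightarrow> A_functional p \<delta> f R z = ennreal (a z)"
    using fin by eventually_elim (simp add: a_def)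
  have v: "measure lebesgue P = t ^ n * measure lebesgue R"
    using t by (simp add: P_def measure_homothety n_def)
  have "wmeasure w P \<le> wmeasure w R"
    unfolding wmeasure_def using PR by (intro nn_integral_mono) (auto split: split_indicator)
  then obtain w' where w': "wmeasure w P = ennreal w'" "0 \<le> w'"
    using W by (cases "wmeasure w P") (auto simp: top_unique)
  \<comment> \<open>A_q is applied to R with E = P. Besides the lower bound for w(P) this yields
    w(P) > 0, which the A_p test on P requires.\<close>
  have "t ^ n * measure lebesgue R \<le> measure lebesgue R * (K * w' / W) powr (1 / q)"
    unfolding v[symmetric] using w'
    by (intro measure_le_Ar_const[OF q w K R W _ PR]) auto
  then have "t ^ n \<le> (K * w' / W) powr (1 / q)" using Rp(4) by (simp add: mult.commute)
  then have "(t ^ n) powr q \<le> ((K * w' / W) powr (1 / q)) powr q"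
    using t q by (intro powr_mono2) auto
  then have tq: "t powr (n * q) \<le> K * w' / W"
    using q t K w' W by (simp add: powr_powr powr_realpow[symmetric])
  moreover have "0 < t powr (n * q)" using t by simp
  ultimately have "0 < K * w' / W" by linarith
  then have w'0: "0 < w'" using w' K W by (auto simp: zero_less_divide_iff zero_less_mult_iff)
  have ratio: "L * (W * N) / w' \<le> L * N * K * t powr (- (n * q))"
  proof -
    have "W / w' \<le> K * t powr (- (n * q))"
      using tq w'0 W t by (simp add: powr_minus field_simps)
    from mult_left_mono[OF this, of "L * N"] show ?thesis using L N by (simp add: mult_ac)
  qed
  have "(\<integral>\<^sup>+z\<in>P. ennreal \<bar>average P f - f z\<bar> \<partial>lebesgue)
      \<le> (\<integral>\<^sup>+z. ennreal (D * t powr \<delta>) * (ennreal (a z powr (1 / p)) * indicator P z) \<partial>lebesgue)"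
  proof (intro nn_integral_mono_AE, use aA in eventually_elim)
    fix z assume aA: "z \<in> R \<longrightarrow> A_functional p \<delta> f R z = ennreal (a z)"
    show "ennreal \<bar>average P f - f z\<bar> * indicator P z \<le> ennreal (D * t powr \<delta>) * (ennreal (a z powr (1 / p)) * indicator P z)"
    proof (cases "z \<in> P")
      case True
      then have "\<bar>f z - average P f\<bar> \<le> D * t powr \<delta> * a z powr (1 / p)"
        unfolding P_def D_def using aA PR a0 t True
        by (intro abs_diff_average_homothety_le[OF f R p \<delta> x]) (auto simp: P_def)
      then show ?thesis
        using True D0 by (simp add: ennreal_mult[symmetric] abs_minus_commute ennreal_leI)
    qed simp
  qed
  also have "\<dots> = ennreal (D * t powr \<delta>) * (\<integral>\<^sup>+z\<in>P. ennreal (a z powr (1 / p)) \<partial>lebesgue)"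
    by (intro nn_integral_cmult) measurable
  also have "\<dots> \<le> ennreal (D * t powr \<delta>) * ennreal (measure lebesgue P * (L * (W * N) / w') powr (1 / p))"
  proof (intro mult_left_mono Ar_test[OF p w L Pr w'(1) w'0 a_meas a0])
    have "(\<integral>\<^sup>+z\<in>P. ennreal (a z * w z) \<partial>lebesgue) \<le> (\<integral>\<^sup>+z\<in>R. A_functional p \<delta> f R z * ennreal (w z) \<partial>lebesgue)"
    proof (intro nn_integral_mono_AE, use aA in eventually_elim)
      fix z assume "z \<in> R \<longrightarrow> A_functional p \<delta> f R z = ennreal (a z)"
      then show "ennreal (a z * w z) * indicator P z \<le> A_functional p \<delta> f R z * ennreal (w z) * indicator R z"
        using PR w a0[of z] by (auto simp: weight_def ennreal_mult split: split_indicator)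
    qed
    then show "(\<integral>\<^sup>+z\<in>P. ennreal (a z * w z) \<partial>lebesgue) \<le> ennreal (W * N)" using int by (rule order_trans)
  qed (use W N in auto)
  also have "\<dots> = ennreal (D * t powr \<delta> * (measure lebesgue P * (L * (W * N) / w') powr (1 / p)))"
    using D0 by (intro ennreal_mult[symmetric]) auto
  also have "\<dots> \<le> ennreal (measure lebesgue P * (D * (L * N * K) powr (1 / p) * t powr (\<delta> - n * q / p)))"
  proof (rule ennreal_leI)
    have "(L * (W * N) / w') powr (1 / p) \<le> (L * N * K * t powr (- (n * q))) powr (1 / p)"
      using ratio L W N w'0 p by (intro powr_mono2) auto
    also have "\<dots> = (L * N * K) powr (1 / p) * t powr (- (n * q / p))"
      using L N K by (simp add: powr_mult powr_powr)
    finally have "D * t powr \<delta> * (measure lebesgue P * (L * (W * N) / w') powr (1 / p))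
        \<le> D * t powr \<delta> * (measure lebesgue P * ((L * N * K) powr (1 / p) * t powr (- (n * q / p))))"
      using D0 by (intro mult_left_mono) auto
    also have "\<dots> = measure lebesgue P * (D * (L * N * K) powr (1 / p) * (t powr \<delta> * t powr (- (n * q / p))))"
      by (simp add: mult_ac)
    also have "t powr \<delta> * t powr (- (n * q / p)) = t powr (\<delta> - n * q / p)"
      by (simp add: powr_add[symmetric])
    finally show "D * t powr \<delta> * (measure lebesgue P * (L * (W * N) / w') powr (1 / p))
      \<le> measure lebesgue P * (D * (L * N * K) powr (1 / p) * t powr (\<delta> - n * q / p))" .
  qed
  finally show ?thesis by (simp only: P_def n_def)
qed

text \<open>The deviation from the larger average is integrated over the smaller cell; enlarging
  that domain costs the volume ratio 2 ^ n.\<close>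

lemma average_homothety_half_le:
  fixes f :: "real ^ 'n \<Rightarrow> real"
  assumes f: "locally_integrable f" and R: "R \<in> rectangles" and x: "x \<in> R" and t: "0 < t" "t \<le> 1"
    and B: "(\<integral>\<^sup>+z\<in>homothety x t R. ennreal \<bar>average (homothety x t R) f - f z\<bar> \<partial>lebesgue)
      \<le> ennreal (measure lebesgue (homothety x t R) * B)" "0 \<le> B"
  shows "\<bar>average (homothety x t R) f - average (homothety x (t / 2) R) f\<bar> \<le> 2 ^ CARD('n) * B"
proof -
  define P where "P = homothety x t R"
  define Q where "Q = homothety x (t / 2) R"
  note Rp = rectangles_properties[OF R]
  have "Q \<in> rectangles" unfolding Q_def using R t by (intro homothety_rectangles) auto
  note Qp = rectangles_properties[OF this]
  have QP: "Q \<subseteq> P" unfolding P_def Q_def using Rp x t by (intro homothety_mono) auto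
  have v: "measure lebesgue P = 2 ^ CARD('n) * measure lebesgue Q"
    using t by (simp add: P_def Q_def measure_homothety power_divide)
  have "ennreal (measure lebesgue Q * \<bar>average P f - average Q f\<bar>) \<le> (\<integral>\<^sup>+z\<in>Q. ennreal \<bar>average P f - f z\<bar> \<partial>lebesgue)"
    using f Qp by (intro abs_diff_average_le locally_integrable_integrable_on) auto
  also have "\<dots> \<le> (\<integral>\<^sup>+z\<in>P. ennreal \<bar>average P f - f z\<bar> \<partial>lebesgue)"
    using QP by (intro nn_integral_mono) (auto split: split_indicator)
  also have "\<dots> \<le> ennreal (measure lebesgue P * B)" using B by (simp only: P_def)
  finally have "measure lebesgue Q * \<bar>average P f - average Q f\<bar> \<le> measure lebesgue Q * (2 ^ CARD('n) * B)"
    using B v by (simp add: mult_ac)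
  from mult_left_le_imp_le[OF this Qp(4)] show ?thesis by (simp only: P_def Q_def)
qed

text \<open>The ratio r will depend on q and \<delta>; bounding the denominator through a lower
  bound s keeps the constant free of them.\<close>

lemma geometric_sum_le:
  fixes r s :: real
  assumes "1 < s" "s \<le> r"
  shows "(\<Sum>j<k. r ^ j) \<le> r ^ k / (s - 1)"
proof -
  have "(\<Sum>j<k. r ^ j) = (r ^ k - 1) / (r - 1)" using assms by (simp add: geometric_sum)
  also have "\<dots> \<le> r ^ k / (s - 1)" using assms by (intro frac_le) auto
  finally show ?thesis .
qed

text \<open>Telescope from R to the k-th cell: the bounds on the differences grow geometrically, so
  their sum is comparable to the last one. Only the final comparison of f x with the k-th average
  sees A(R,x); the differences see only the global quantity N.\<close>

lemma abs_diff_average_chain_le: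
  fixes f w :: "real ^ 'n \<Rightarrow> real"
  assumes f: "locally_integrable f" and R: "R \<in> rectangles"
    and p: "1 \<le> p" "p < real CARD('n)" and q: "1 \<le> q" and \<delta>: "0 \<le> \<delta>" "\<delta> \<le> 1" and x: "x \<in> R"
    and w: "weight w" and K: "Ar_const q w = ennreal K" "0 \<le> K" and L: "Ar_const p w = ennreal L" "0 \<le> L"
    and W: "wmeasure w R = ennreal W" "0 < W" and N: "0 \<le> N"
    and fin: "AE z in lebesgue. z \<in> R \<longrightarrow> A_functional p \<delta> f R z < top"
    and int: "(\<integral>\<^sup>+z\<in>R. A_functional p \<delta> f R z * ennreal (w z) \<partial>lebesgue) \<le> ennreal (W * N)"
    and a: "A_functional p \<delta> f R x = ennreal a" "0 \<le> a"
  defines "D \<equiv> diameter R powr (real CARD('n) / p + \<delta>) / measure lebesgue R powr (1 / p)"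
    and "c \<equiv> 2 ^ CARD('n) / (2 powr (real CARD('n) / p - 1) - 1)"
  shows "\<bar>f x - average R f\<bar> \<le> D * 2 powr (- (real k * \<delta>)) * a powr (1 / p)
    + c * D * (L * N * K) powr (1 / p) * 2 powr (real k * (real CARD('n) * q / p - \<delta>))"
proof -
  define n where "n = CARD('n)"
  define P where "P j = homothety x ((1 / 2) ^ j) R" for j :: nat
  define E where "E = D * (L * N * K) powr (1 / p)"
  define \<rho> where "\<rho> = 2 powr (n * q / p - \<delta>)"
  have E0: "0 \<le> E" by (simp add: E_def D_def)
  have tpow: "((1 / 2) ^ j) powr s = (2 powr (- s)) ^ j" for s :: real and j :: nat
  proof -
    have "(1 / 2 :: real) ^ j = 2 powr (- real j)"
      by (simp add: powr_minus_divide powr_realpow power_divide)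
    then have "((1 / 2 :: real) ^ j) powr s = 2 powr (- s * real j)"
      by (simp only: powr_powr) (simp add: mult.commute)
    also have "\<dots> = (2 powr (- s)) ^ j"
      using powr_realpow[of "2 powr (- s)" j] by (simp add: powr_powr)
    finally show ?thesis .
  qed
  have step: "\<bar>average (P j) f - average (P (Suc j)) f\<bar> \<le> 2 ^ n * E * \<rho> ^ j" for j
  proof -
    have t: "0 < (1 / 2 :: real) ^ j" "(1 / 2 :: real) ^ j \<le> 1" by (simp_all add: power_le_one)
    have "\<bar>average (P j) f - average (homothety x ((1 / 2) ^ j / 2) R) f\<bar>
        \<le> 2 ^ CARD('n) * (D * (L * N * K) powr (1 / p) * ((1 / 2) ^ j) powr (\<delta> - real CARD('n) * q / p))"
      unfolding P_def D_def
      by (intro average_homothety_half_le[OF f R x t] homothety_Poincare[OF f R p(1) q \<delta>(1) x t w K L W N fin int])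
        simp
    then show ?thesis
      unfolding tpow by (simp add: P_def n_def E_def \<rho>_def mult.assoc)
  qed
  have "\<bar>average (P 0) f - average (P k) f\<bar> \<le> (\<Sum>j<k. \<bar>average (P j) f - average (P (Suc j)) f\<bar>)"
  proof (induction k)
    case (Suc k)
    then show ?case by simp
  qed simp
  also have "\<dots> \<le> (\<Sum>j<k. 2 ^ n * E * \<rho> ^ j)" by (intro sum_mono step)
  also have "\<dots> = 2 ^ n * E * (\<Sum>j<k. \<rho> ^ j)" by (simp add: sum_distrib_left)
  also have "\<dots> \<le> 2 ^ n * E * (\<rho> ^ k / (2 powr (n / p - 1) - 1))"
  proof (intro mult_left_mono geometric_sum_le)
    \<comment> \<open>n / p - 1 is positive by p < n, and it is a lower bound for n * q / p -
      \<delta> by q \<ge> 1 and \<delta> \<le> 1.\<close>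
    show "1 < 2 powr (n / p - 1)" using p by (simp add: n_def)
    have "real n * 1 \<le> n * q" using q by (intro mult_left_mono) auto
    then have "n / p \<le> n * q / p" using p by (intro divide_right_mono) auto
    then show "2 powr (n / p - 1) \<le> \<rho>" using \<delta> by (simp add: \<rho>_def)
  qed (use E0 in auto)
  also have "\<dots> = c * E * \<rho> ^ k" by (simp add: c_def n_def)
  also have "\<rho> ^ k = 2 powr (k * (n * q / p - \<delta>))"
    using powr_realpow[of \<rho> k] by (simp add: \<rho>_def powr_powr mult.commute)
  finally have 1: "\<bar>average R f - average (P k) f\<bar> \<le> c * D * (L * N * K) powr (1 / p) * 2 powr (k * (n * q / p - \<delta>))"
    by (simp add: P_def E_def mult.assoc)
  have "\<bar>f x - average (P k) f\<bar> \<le> D * ((1 / 2) ^ k) powr \<delta> * a powr (1 / p)"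
    unfolding P_def D_def using a
    by (intro abs_diff_average_homothety_le[OF f R p(1) \<delta>(1) x]) (auto intro: mem_homothety x power_le_one)
  also have "((1 / 2) ^ k) powr \<delta> = 2 powr (- (k * \<delta>))"
    unfolding tpow using powr_realpow[of "2 powr (- \<delta>)" k] by (simp add: powr_powr mult.commute)
  finally show ?thesis using 1 by (simp add: n_def)
qed

section \<open>From the pointwise bound to the inequality on a rectangle\<close>

lemma wmeasure_finite:
  assumes "weight w" "R \<in> lmeasurable" "bounded R"
  shows "wmeasure w R < top"
proof -
  have "set_integrable lebesgue R w"
    using assms by (intro locally_integrable_integrable_on) (auto simp: weight_def)
  then have "(\<integral>\<^sup>+x. ennreal (norm (indicator R x *\<^sub>R w x)) \<partial>lebesgue) < \<infinity>"
    by (auto simp: set_integrable_def integrable_iff_bounded)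
  moreover have "(\<integral>\<^sup>+x. ennreal (norm (indicator R x *\<^sub>R w x)) \<partial>lebesgue) = wmeasure w R"
    unfolding wmeasure_def using assms
    by (intro nn_integral_cong) (auto simp: weight_def split: split_indicator)
  ultimately show ?thesis by simp
qed

lemma average_AE_const:
  fixes f :: "real ^ 'n \<Rightarrow> real"
  assumes f: "locally_integrable f" and R: "R \<in> rectangles"
    and c: "AE x in lebesgue. x \<in> R \<longrightarrow> f x = c"
  shows "average R f = c"
proof -
  note Rp = rectangles_properties[OF R]
  have "ennreal (measure lebesgue R * \<bar>c - average R f\<bar>) \<le> (\<integral>\<^sup>+y\<in>R. ennreal \<bar>c - f y\<bar> \<partial>lebesgue)"
    using f Rp by (intro abs_diff_average_le locally_integrable_integrable_on) auto
  also have "\<dots> = (\<integral>\<^sup>+y. 0 \<partial>(lebesgue :: (real ^ 'n) measure))"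
    by (intro nn_integral_cong_AE, use c in eventually_elim) (auto split: split_indicator)
  finally have "measure lebesgue R * \<bar>c - average R f\<bar> \<le> 0"
    by (simp add: ennreal_eq_0_iff)
  then show ?thesis using Rp(4) by (simp add: mult_le_0_iff)
qed

text \<open>The kernel is positive off the diagonal, so the integrand can vanish only where f y = f
  x; at y = x there is nothing to prove.\<close>

lemma A_functional_eq_0:
  fixes f :: "real ^ 'n \<Rightarrow> real"
  assumes f: "f \<in> borel_measurable lebesgue" and R [measurable]: "R \<in> sets lebesgue"
    and z: "A_functional p \<delta> f R x = 0"
  shows "AE y in lebesgue. y \<in> R \<longrightarrow> f y = f x"
proof -
  have [measurable]: "(\<lambda>y. norm (x - y)) \<in> borel_measurable lebesgue"
    by (intro measurable_completion) simp
  have [measurable]: "f \<in> borel_measurable lebesgue" by (rule f)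
  have "AE y in lebesgue. ennreal (\<bar>f x - f y\<bar> powr p / norm (x - y) powr (real CARD('n) + \<delta> * p)) * indicator R y = 0"
    using z unfolding A_functional_def by (subst (asm) nn_integral_0_iff_AE) simp_all
  then show ?thesis
  proof eventually_elim
    case (elim y)
    then show ?case
      by (cases "y = x") (auto simp: ennreal_eq_0_iff divide_le_0_iff split: split_indicator_asm)
  qed
qed

text \<open>With \<sigma> = 1/p - 1/s the optimised bound contains (a / N) powr (1 / s), so its s-th
  power is linear in A(R,x). Integrating against w gives W * N, and N cancels.\<close>

lemma Poincare_Sobolev_scale_le_1:
  fixes f w :: "real ^ 'n \<Rightarrow> real"
  assumes f: "locally_integrable f" and R: "R \<in> rectangles"
    and p: "1 \<le> p" "p < real CARD('n)" and q: "1 \<le> q" and \<delta>: "0 < \<delta>" "\<delta> \<le> 1"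
    and w: "weight w" and K: "Ar_const q w = ennreal K" "1 \<le> K" and L: "Ar_const p w = ennreal L" "1 \<le> L"
    and W: "wmeasure w R = ennreal W" "0 < W" and N: "0 < N"
    and fin: "AE z in lebesgue. z \<in> R \<longrightarrow> A_functional p \<delta> f R z < top"
    and int: "(\<integral>\<^sup>+z\<in>R. A_functional p \<delta> f R z * ennreal (w z) \<partial>lebesgue) = ennreal (W * N)"
    and s: "0 < s" "1 / p - 1 / s = \<delta> / real CARD('n) * (1 / (q + ln K))"
  defines "D \<equiv> diameter R powr (real CARD('n) / p + \<delta>) / measure lebesgue R powr (1 / p)"
    and "c \<equiv> 2 ^ CARD('n) / (2 powr (real CARD('n) / p - 1) - 1)"
  shows "(\<integral>\<^sup>+x\<in>R. ennreal (\<bar>f x - average R f\<bar> powr s * w x) \<partial>lebesgue)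
    \<le> ennreal (W * (2 * (1 + c) * exp 1 * D * L powr (1 / p) * N powr (1 / p)) powr s)"
proof -
  define n where "n = real CARD('n)"
  define T where "T = 2 * (1 + c) * exp 1 * D * L powr (1 / p) * N powr (1 / p)"
  note Rp = rectangles_properties[OF R]
  have [measurable]: "R \<in> sets lebesgue" using Rp by auto
  have [measurable]: "w \<in> borel_measurable lebesgue"
    using w by (auto simp: weight_def intro: locally_integrable_measurable)
  have [measurable]: "A_functional p \<delta> f R \<in> borel_measurable lebesgue"
    using locally_integrable_measurable[OF f] Rp(1) by (rule A_functional_measurable)
  have w0: "0 \<le> w x" for x using w by (auto simp: weight_def)
  have "2 powr 0 < 2 powr (n / p - 1)" using p by (intro powr_less_mono) (auto simp: n_def)
  then have c0: "0 \<le> c" by (simp add: c_def n_def)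
  have D0: "0 \<le> D" by (simp add: D_def)
  have T0: "0 \<le> T" using c0 D0 by (simp add: T_def)
  have pt: "\<bar>f x - average R f\<bar> powr s \<le> T powr s / N * a"
    if x: "x \<in> R" and a: "A_functional p \<delta> f R x = ennreal a" "0 \<le> a" for x a
  proof -
    have "\<bar>f x - average R f\<bar> \<le> 2 * (1 + c) * exp 1 * D * L powr (1 / p) * N powr (1 / p)
        * (a / N) powr (1 / p - (1 / p - 1 / s))"
    proof (rule scale_optimization[of "real CARD('n)" _ q \<delta> K])
      show "\<bar>f x - average R f\<bar> \<le> D * a powr (1 / p)"
        using abs_diff_average_homothety_le[OF f R p(1) _ x _ _ _ a, of 1] \<delta> x by (simp add: D_def)
      show "\<bar>f x - average R f\<bar> \<le> D * 2 powr (- (real k * \<delta>)) * a powr (1 / p)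
        + c * D * (L * N * K) powr (1 / p) * 2 powr (real k * (real CARD('n) * q / p - \<delta>))" for k
        unfolding D_def c_def using \<delta> K L N
        by (intro abs_diff_average_chain_le[OF f R p q _ _ x w K(1) _ L(1) _ W _ fin eq_refl[OF int] a]) auto
    qed (use p q \<delta> K L N a D0 c0 s(2) in auto)
    then have "\<bar>f x - average R f\<bar> \<le> T * (a / N) powr (1 / s)" by (simp add: T_def)
    then have "\<bar>f x - average R f\<bar> powr s \<le> (T * (a / N) powr (1 / s)) powr s"
      using s by (intro powr_mono2) auto
    also have "\<dots> = T powr s / N * a"
      using T0 N a s by (simp add: powr_mult powr_powr)
    finally show ?thesis .
  qed
  have "(\<integral>\<^sup>+x\<in>R. ennreal (\<bar>f x - average R f\<bar> powr s * w x) \<partial>lebesgue)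
      \<le> (\<integral>\<^sup>+x. ennreal (T powr s / N) * (A_functional p \<delta> f R x * ennreal (w x) * indicator R x) \<partial>lebesgue)"
  proof (intro nn_integral_mono_AE, use fin in eventually_elim)
    fix x assume fin: "x \<in> R \<longrightarrow> A_functional p \<delta> f R x < top"
    show "ennreal (\<bar>f x - average R f\<bar> powr s * w x) * indicator R x
      \<le> ennreal (T powr s / N) * (A_functional p \<delta> f R x * ennreal (w x) * indicator R x)"
    proof (cases "x \<in> R")
      case True
      with fin obtain a where a: "A_functional p \<delta> f R x = ennreal a" "0 \<le> a"
        by (cases "A_functional p \<delta> f R x") auto
      have "\<bar>f x - average R f\<bar> powr s * w x \<le> T powr s / N * (a * w x)"
        using mult_right_mono[OF pt[OF True a] w0[of x]] by (simp only: mult.assoc)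
      then have "ennreal (\<bar>f x - average R f\<bar> powr s * w x) \<le> ennreal (T powr s / N) * (ennreal a * ennreal (w x))"
        using N a w0[of x] by (simp add: ennreal_mult[symmetric] ennreal_leI)
      then show ?thesis using True by (simp add: a)
    qed simp
  qed
  also have "\<dots> = ennreal (T powr s / N) * ennreal (W * N)"
    unfolding int[symmetric] by (intro nn_integral_cmult) measurable
  also have "\<dots> = ennreal (T powr s / N * (W * N))"
    using N W by (intro ennreal_mult[symmetric]) auto
  also have "T powr s / N * (W * N) = W * T powr s" using N by simp
  finally show ?thesis by (simp only: T_def)
qed

lemma ennreal_prod_eq_top:
  fixes a b c d :: ennreal
  assumes "a \<noteq> 0" "b \<noteq> 0" "c \<noteq> 0" "d \<noteq> 0" "b = top \<or> d = top"
  shows "a * b * c * d = top"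
  using assms by (auto simp: ennreal_mult_eq_top_iff)

text \<open>The normalisation in \<open>Poincare_Sobolev_scale_le_1\<close> needs positive W and N
  and finite constants. The excluded cases make either the left side 0 or the right side
  \<open>top\<close>.\<close>

lemma Poincare_Sobolev_rectangle:
  fixes f w :: "real ^ 'n \<Rightarrow> real"
  assumes f: "locally_integrable f" and R: "R \<in> rectangles"
    and p: "1 \<le> p" "p < real CARD('n)" and q: "1 \<le> q" and \<delta>: "0 < \<delta>"
    and w: "weight w" and K: "Ar_const q w < top"
    and s: "0 < s" "1 / p - 1 / s = \<delta> / real CARD('n) * (1 / (q + ln (enn2real (Ar_const q w))))"
  defines "C \<equiv> 2 * (1 + 2 ^ CARD('n) / (2 powr (real CARD('n) / p - 1) - 1)) * exp 1"
  shows "((1 / wmeasure w R) *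
         (\<integral>\<^sup>+x\<in>R. ennreal (\<bar>f x - average R f\<bar> powr s * w x) \<partial>lebesgue)) epowr (1 / s)
      \<le> ennreal (C * (1 / \<delta>)) * Ar_const p w epowr (1 / p) *
         ennreal (diameter R powr \<delta> / eccentricity R powr (real CARD('n) / p)) *
         ((1 / wmeasure w R) *
           (\<integral>\<^sup>+x\<in>R. A_functional p \<delta> f R x * ennreal (w x) \<partial>lebesgue)) epowr (1 / p)"
    (is "?lhs \<le> ?rhs")
proof -
  define n where "n = real CARD('n)"
  note Rp = rectangles_properties[OF R]
  have [measurable]: "R \<in> sets lebesgue" using Rp by auto
  have w_meas [measurable]: "w \<in> borel_measurable lebesgue"
    using w by (auto simp: weight_def intro: locally_integrable_measurable)
  have f_meas [measurable]: "f \<in> borel_measurable lebesgue" using f by (rule locally_integrable_measurable)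
  have A_meas [measurable]: "A_functional p \<delta> f R \<in> borel_measurable lebesgue"
    using f_meas Rp(1) by (rule A_functional_measurable)
  have w0: "0 \<le> w x" for x using w by (auto simp: weight_def)
  have trivial: "?lhs \<le> ?rhs" if "AE x in lebesgue. x \<in> R \<longrightarrow> \<bar>f x - average R f\<bar> powr s * w x = 0"
  proof -
    have "(\<integral>\<^sup>+x\<in>R. ennreal (\<bar>f x - average R f\<bar> powr s * w x) \<partial>lebesgue) = (\<integral>\<^sup>+x. 0 \<partial>(lebesgue :: (real ^ 'n) measure))"
      by (intro nn_integral_cong_AE, use that in eventually_elim) (auto split: split_indicator)
    then have "?lhs = 0 epowr (1 / s)" by simp
    also have "\<dots> = 0" using s by (simp add: epowr_def)
    finally show ?thesis by simp
  qed
  have const: "?lhs \<le> ?rhs" if "\<exists>c. AE x in lebesgue. x \<in> R \<longrightarrow> f x = c"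
  proof -
    from that obtain c where c: "AE x in lebesgue. x \<in> R \<longrightarrow> f x = c" ..
    have "average R f = c" using f R c by (rule average_AE_const)
    with c show ?thesis by (intro trivial) (auto elim: eventually_mono)
  qed
  obtain W where W: "wmeasure w R = ennreal W" "0 \<le> W"
    using wmeasure_finite[OF w Rp(3,2)] by (cases "wmeasure w R") auto
  obtain K' where K': "Ar_const q w = ennreal K'" "0 \<le> K'"
    using K by (cases "Ar_const q w") auto
  show ?thesis
  proof (cases "W = 0")
    case True
    then have "AE x in lebesgue. ennreal (w x) * indicator R x = 0"
      using W unfolding wmeasure_def by (subst nn_integral_0_iff_AE[symmetric]) simp_all
    then have "AE x in lebesgue. x \<in> R \<longrightarrow> \<bar>f x - average R f\<bar> powr s * w x = 0"
    proof eventually_elim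
      case (elim x)
      then show ?case using w0[of x] by (auto simp: ennreal_eq_0_iff)
    qed
    then show ?thesis by (rule trivial)
  next
    case False
    with W have W0: "0 < W" by simp
    have inv: "1 / ennreal W = ennreal (1 / W)" using divide_ennreal[of 1 W] W0 by simp
    have K1: "1 \<le> K'" using Ar_const_ge_1[OF q w K' R W(1) W0] .
    have wpos: "AE x in lebesgue. x \<in> R \<longrightarrow> 0 < w x" using weight_AE_pos[OF q w K' R W(1) W0] .
    define I where "I = (\<integral>\<^sup>+x\<in>R. A_functional p \<delta> f R x * ennreal (w x) \<partial>lebesgue)"
    have d0: "0 < diameter R"
    proof (rule ccontr)
      assume "\<not> 0 < diameter R"
      then have "diameter R = 0" using diameter_ge_0[OF Rp(2)] by linarith
      obtain x where x: "x \<in> R" using Rp(5) interior_subset by blast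
      have "R \<subseteq> {x}"
        using diameter_bounded_bound[OF Rp(2) x] \<open>diameter R = 0\<close> by auto
      then have "negligible R" by (rule negligible_subset[rotated]) simp
      then show False using Rp(3,4) by (simp add: negligible_iff_measure)
    qed
    define D where "D = diameter R powr (n / p + \<delta>) / measure lebesgue R powr (1 / p)"
    have D: "diameter R powr \<delta> / eccentricity R powr (real CARD('n) / p) = D"
      unfolding eccentricity_def D_def n_def[symmetric] using d0 Rp(4)
      by (simp add: powr_divide powr_powr n_def powr_add mult.commute)
    have D0: "0 < D" using d0 Rp(4) by (simp add: D_def)
    have "2 powr 0 < 2 powr (n / p - 1)" using p by (intro powr_less_mono) (auto simp: n_def)
    then have C0: "0 < C"
      unfolding C_def n_def[symmetric] by (intro mult_pos_pos add_pos_nonneg) auto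
    \<comment> \<open>Since 0 * top = 0 in \<open>ennreal\<close>, an infinite factor makes the
      right side \<open>top\<close> only if no other factor vanishes.\<close>
    have Ar_pos: "Ar_const p w epowr (1 / p) \<noteq> 0"
    proof (cases "Ar_const p w")
      case (real L)
      then have "1 \<le> L" using Ar_const_ge_1[OF p(1) w _ _ R W(1) W0] by blast
      then show ?thesis using real p by (simp add: ennreal_epowr)
    next
      case top
      then show ?thesis using p by (simp add: top_epowr)
    qed
    show ?thesis
    proof (cases "I = 0")
      \<comment> \<open>This case is separated because the optimisation divides by N; as w is
        positive almost everywhere, A(R,x) = 0 for almost every x in R.\<close>
      case True
      then have "AE x in lebesgue. A_functional p \<delta> f R x * ennreal (w x) * indicator R x = 0"
        unfolding I_def by (subst nn_integral_0_iff_AE[symmetric]) simp_all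
      then have "AE x in lebesgue. x \<in> R \<longrightarrow> (AE y in lebesgue. y \<in> R \<longrightarrow> f y = f x)"
        using wpos
      proof eventually_elim
        case (elim x)
        show ?case
        proof
          assume "x \<in> R"
          then have "A_functional p \<delta> f R x = 0" using elim by simp
          then show "AE y in lebesgue. y \<in> R \<longrightarrow> f y = f x"
            by (intro A_functional_eq_0[OF f_meas]) simp_all
        qed
      qed
      then show ?thesis by (intro const AE_const_on)
    next
      case I0: False
      have Iavg: "(1 / ennreal W * I) epowr (1 / p) \<noteq> 0"
      proof (cases I)
        case (real i)
        then have "0 < i" using I0 by (auto simp: less_le)
        then show ?thesis
          using real W0 p by (simp add: inv ennreal_epowr ennreal_mult[symmetric])
      next
        case top
        then show ?thesis using W0 p by (simp add: inv ennreal_mult_top top_epowr)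
      qed
      show ?thesis
      proof (cases "Ar_const p w = top \<or> I = top")
        case True
        have "?rhs = top"
          unfolding W I_def[symmetric] D
        proof (rule ennreal_prod_eq_top[OF _ Ar_pos _ Iavg])
          show "Ar_const p w epowr (1 / p) = top \<or> (1 / ennreal W * I) epowr (1 / p) = top"
            using True p W0 by (auto simp: inv top_epowr ennreal_mult_top)
        qed (use C0 D0 \<delta> in auto)
        then show ?thesis by simp
      next
        case False
        then obtain L where L: "Ar_const p w = ennreal L" "0 \<le> L" by (cases "Ar_const p w") auto
        have L1: "1 \<le> L" using Ar_const_ge_1[OF p(1) w L R W(1) W0] .
        obtain i where i: "I = ennreal i" "0 \<le> i" using False by (cases I) auto
        \<comment> \<open>The average of A(R,.) with respect to w, so the last factor on the right
          is N powr (1 / p).\<close>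
        define N where "N = i / W"
        have N: "0 < N" "I = ennreal (W * N)" using i I0 W0 by (auto simp: N_def less_le)
        have fin: "AE x in lebesgue. x \<in> R \<longrightarrow> A_functional p \<delta> f R x < top"
        proof -
          have "AE x in lebesgue. A_functional p \<delta> f R x * ennreal (w x) * indicator R x \<noteq> \<infinity>"
            using N(2) unfolding I_def by (intro nn_integral_PInf_AE) simp_all
          then show ?thesis using wpos
          proof eventually_elim
            case (elim x)
            then show ?case by (auto simp: less_top ennreal_mult_eq_top_iff)
          qed
        qed
        show ?thesis
        proof (cases "\<delta> \<le> 1")
          case True
          define T where "T = C * D * L powr (1 / p) * N powr (1 / p)"
          have T0: "0 \<le> T" using C0 D0 by (simp add: T_def)
          have "(\<integral>\<^sup>+x\<in>R. ennreal (\<bar>f x - average R f\<bar> powr s * w x) \<partial>lebesgue) \<le> ennreal (W * T powr s)"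
            unfolding T_def C_def D_def n_def
            using Poincare_Sobolev_scale_le_1[OF f R p q \<delta> True w K'(1) K1 L(1) L1 W(1) W0 N(1) fin _ s(1)]
              s(2) K' N(2) by (simp add: I_def)
          then have "?lhs \<le> (1 / ennreal W * ennreal (W * T powr s)) epowr (1 / s)"
            unfolding W using s by (intro epowr_mono mult_left_mono) auto
          also have "1 / ennreal W * ennreal (W * T powr s) = ennreal (T powr s)"
            using W0 by (simp add: inv ennreal_mult[symmetric])
          also have "ennreal (T powr s) epowr (1 / s) = ennreal T"
            using s T0 by (simp add: ennreal_epowr powr_powr)
          also have "\<dots> \<le> ennreal (C * (1 / \<delta>) * L powr (1 / p) * D * N powr (1 / p))"
          proof (rule ennreal_leI)
            \<comment> \<open>For \<delta> \<le> 1 the factor 1 / \<delta> is at least 1 and is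
              inserted only here.\<close>
            have "T * 1 \<le> T * (1 / \<delta>)" using T0 \<delta> True by (intro mult_left_mono) auto
            then show "T \<le> C * (1 / \<delta>) * L powr (1 / p) * D * N powr (1 / p)"
              by (simp add: T_def mult_ac)
          qed
          also have "\<dots> = ?rhs"
          proof -
            have "1 / ennreal W * I = ennreal N"
              using W0 N by (simp add: inv ennreal_mult[symmetric])
            then have "(1 / wmeasure w R * I) epowr (1 / p) = ennreal (N powr (1 / p))"
              unfolding W using N p by (simp add: ennreal_epowr)
            moreover have "Ar_const p w epowr (1 / p) = ennreal (L powr (1 / p))"
              unfolding L using L1 p by (simp add: ennreal_epowr)
            moreover have "0 \<le> C * (1 / \<delta>)" using C0 \<delta> by simp
            ultimately show ?thesis
              unfolding I_def[symmetric] D using D0 by (simp only: ennreal_mult powr_ge_zero mult_nonneg_nonneg less_imp_le)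
          qed
          finally show ?thesis .
        next
          case False
          have "(\<integral>\<^sup>+x\<in>R. ennreal (enn2real (A_functional p \<delta> f R x) powr (1 / p)) \<partial>lebesgue)
              \<le> ennreal (measure lebesgue R * (L * (W * N) / W) powr (1 / p))"
          proof (rule Ar_test[OF p(1) w L R W(1) W0])
            show "(\<integral>\<^sup>+x\<in>R. ennreal (enn2real (A_functional p \<delta> f R x) * w x) \<partial>lebesgue) \<le> ennreal (W * N)"
              unfolding N(2)[symmetric] I_def
            proof (intro nn_integral_mono_AE, use fin in eventually_elim)
              case (elim x)
              then show ?case using w0[of x] by (auto simp: ennreal_mult split: split_indicator)
            qed
          qed (use W N in auto)
          from A_functional_const[OF f_meas Rp(1,2) p(1) _ fin this] False
          show ?thesis by (intro const) simp
        qed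
      qed
    qed
  qed
qed

theorem corollary2p11:
  fixes p q :: real
  assumes "1 \<le> q" and "q \<le> p" and "p < real CARD('n::finite)"
  shows "\<exists>C>0. \<forall>(w :: real ^ 'n \<Rightarrow> real) \<delta> pstar.
    w \<in> Ar_class q \<longrightarrow> 0 < \<delta> \<longrightarrow> 0 < pstar \<longrightarrow>
    1 / p - 1 / pstar = \<delta> / real CARD('n) * (1 / (q + ln (enn2real (Ar_const q w)))) \<longrightarrow>
    (\<forall>f. locally_integrable f \<longrightarrow> (\<forall>R\<in>rectangles.
      ((1 / wmeasure w R) *
         (\<integral>\<^sup>+x\<in>R. ennreal (\<bar>f x - average R f\<bar> powr pstar * w x) \<partial>lebesgue)) epowr (1 / pstar)
      \<le> ennreal (C * (1 / \<delta>)) * Ar_const p w epowr (1 / p) *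
         ennreal (diameter R powr \<delta> / eccentricity R powr (real CARD('n) / p)) *
         ((1 / wmeasure w R) *
           (\<integral>\<^sup>+x\<in>R. A_functional p \<delta> f R x * ennreal (w x) \<partial>lebesgue)) epowr (1 / p)))"
proof -
  \<comment> \<open>2 and exp 1 come from the choice of scale, the fraction from the geometric sum;
    p < n makes its denominator positive.\<close>
  let ?C = "2 * (1 + 2 ^ CARD('n) / (2 powr (real CARD('n) / p - 1) - 1)) * exp 1 :: real"
  have "2 powr 0 < 2 powr (real CARD('n) / p - 1)"
    using assms by (intro powr_less_mono) auto
  then have "0 < ?C" by (intro mult_pos_pos add_pos_nonneg) auto
  then show ?thesis
    using assms by (intro exI[of _ ?C] conjI allI impI ballI Poincare_Sobolev_rectangle)
      (auto simp: Ar_class_def)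
qed

end
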